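(* Let $P_0=\mathcal{N}(m_0,\Sigma_0)$ and $P_1=\mathcal{N}(m_1,\Sigma_1)$ with $m_i\in\mathbb{R}^d$ and $\Sigma_i\in\mathbb{R}^{d\times d}$ symmetric positive definite, $i=0,1$. Then there exist a diagonal matrix $\Lambda$ and a matrix $V$ such that $\Sigma_0=VV^\top$ and $\Sigma_1=V\Lambda V^\top$, and for $\Sigma_Z:=V\Lambda^{1/2}V^\top$ one has that $\Sigma_Z$ is symmetric positive definite and the generalized interpolant defined by $F(t,x,y,z)=(1-t)x+ty+\sqrt{2t(1-t)}\,z$ and $Q=\mathcal{N}(0,\Sigma_Z)$ satisfies $(F,Q)\in\mathcal{F}_{\mathrm{SL}}(P_0,P_1)$.
   Context: Fix $1\le p<2$. A base interpolation path is a Borel map $F:[0,1]\times\mathbb{R}^{2d+\ell}\to\mathbb{R}^d$ with $t\mapsto F(t,x,y,z)\in W^{1,p}([0,1];\mathbb{R}^d)$, $F(0,x,y,z)=x$, $F(1,x,y,z)=y$ for a.e. $(x,y,z)$. A generalized interpolant is $(F,Q)$ with $Q$ absolutely continuous on $\mathbb{R}^\ell$, inducing $X_t=F(t,X_0,X_1,Z)$ with $(X_0,X_1,Z)\sim P_0\otimes P_1\otimes Q$. $\mathcal{S}(P_0,P_1)$: processes with a.s. continuous paths and $(X_0,X_1)\sim P_0\otimes P_1$. $\mathcal{S}_{\mathrm{SL}}(P_0,P_1)$ (for absolutely continuous $P_0,P_1$): those $X\in\mathcal{S}(P_0,P_1)$ whose conditional velocity $v(t,x)=\mathbb{E}[\dot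 X_t\mid X_t=x]$ is well defined, jointly measurable, Lipschitz in $x$ with constant uniform in $t$, and whose flow map ($\partial_t\phi=v(t,\phi)$, $\phi(0,x)=x$) satisfies $\partial_t^2\phi\equiv0$ on $[0,1]\times\mathbb{R}^d$. $\mathcal{F}_{\mathrm{SL}}(P_0,P_1)$: generalized interpolants whose induced process lies in $\mathcal{S}_{\mathrm{SL}}(P_0,P_1)$. *)

theory Defs
  imports "HOL-Probability.Probability"
begin

definition pos_def_mat :: "real^'n^'n \<Rightarrow> bool" where
  "pos_def_mat S \<longleftrightarrow> transpose S = S \<and> (\<forall>x. x \<noteq> 0 \<longrightarrow> x \<bullet> (S *v x) > 0)"

definition diagonal_mat :: "real^'n^'n \<Rightarrow> bool" where
  "diagonal_mat A \<longleftrightarrow> (\<forall>i j. i \<noteq> j \<longrightarrow> A $ i $ j = 0)"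

definition diag_sqrt :: "real^'n^'n \<Rightarrow> real^'n^'n" where
  "diag_sqrt A = (\<chi> i j. if i = j then sqrt (A $ i $ i) else 0)"

definition gaussian_density :: "real^'n \<Rightarrow> real^'n^'n \<Rightarrow> real^'n \<Rightarrow> real" where
  "gaussian_density m S x =
     exp (- ((x - m) \<bullet> (matrix_inv S *v (x - m))) / 2) / sqrt ((2 * pi) ^ CARD('n) * det S)"

definition gaussian :: "real^'n \<Rightarrow> real^'n^'n \<Rightarrow> (real^'n) measure" where
  "gaussian m S = density lborel (\<lambda>x. ennreal (gaussian_density m S x))"

text \<open>W^{1,p}([0,1]) membership of a path (absolutely continuous representative
  with an L^p derivative).\<close>
definition W1p_path :: "real \<Rightarrow> (real \<Rightarrow> 'a::euclidean_space) \<Rightarrow> bool" where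
  "W1p_path p f \<longleftrightarrow> (\<exists>g. set_integrable lborel {0..1} g \<and>
      set_integrable lborel {0..1} (\<lambda>t. norm (g t) powr p) \<and>
      (\<forall>t\<in>{0..1}. f t = f 0 + (LINT s:{0..t}|lborel. g s)))"

definition base_interp_path ::
  "real \<Rightarrow> (real \<Rightarrow> 'a::euclidean_space \<Rightarrow> 'a \<Rightarrow> 'b::euclidean_space \<Rightarrow> 'a) \<Rightarrow> bool" where
  "base_interp_path p F \<longleftrightarrow>
     (\<lambda>(t, x, y, z). F t x y z) \<in> borel_measurable (restrict_space borel ({0..1} \<times> UNIV)) \<and>
     (AE w in lborel. W1p_path p (\<lambda>t. F t (fst w) (fst (snd w)) (snd (snd w))) \<and>
        F 0 (fst w) (fst (snd w)) (snd (snd w)) = fst w \<and>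
        F 1 (fst w) (fst (snd w)) (snd (snd w)) = fst (snd w))"

definition gen_interp ::
  "real \<Rightarrow> (real \<Rightarrow> 'a::euclidean_space \<Rightarrow> 'a \<Rightarrow> 'b::euclidean_space \<Rightarrow> 'a) \<Rightarrow> 'b measure \<Rightarrow> bool" where
  "gen_interp p F Q \<longleftrightarrow> base_interp_path p F \<and> prob_space Q \<and> sets Q = sets lborel \<and>
     absolutely_continuous lborel Q"

definition induced_process ::
  "(real \<Rightarrow> 'a \<Rightarrow> 'a \<Rightarrow> 'b \<Rightarrow> 'a) \<Rightarrow> real \<Rightarrow> 'a \<times> 'a \<times> 'b \<Rightarrow> 'a" where
  "induced_process F t \<omega> = F t (fst \<omega>) (fst (snd \<omega>)) (snd (snd \<omega>))"

definition in_S :: "'w measure \<Rightarrow> (real \<Rightarrow> 'w \<Rightarrow> 'a::euclidean_space) \<Rightarrow> 'a measure \<Rightarrow> 'a measure \<Rightarrow> bool" where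
  "in_S M X P0 P1 \<longleftrightarrow> prob_space M \<and> (\<forall>t\<in>{0..1}. X t \<in> borel_measurable M) \<and>
     (AE \<omega> in M. continuous_on {0..1} (\<lambda>t. X t \<omega>)) \<and>
     (\<lambda>\<omega>. (X 0 \<omega>, X 1 \<omega>)) \<in> measurable M (P0 \<Otimes>\<^sub>M P1) \<and>
     distr M (P0 \<Otimes>\<^sub>M P1) (\<lambda>\<omega>. (X 0 \<omega>, X 1 \<omega>)) = P0 \<Otimes>\<^sub>M P1"

definition path_velocity :: "(real \<Rightarrow> 'w \<Rightarrow> 'a::real_normed_vector) \<Rightarrow> real \<Rightarrow> 'w \<Rightarrow> 'a" where
  "path_velocity X t \<omega> = vector_derivative (\<lambda>s. X s \<omega>) (at t within {0..1})"

text \<open>v is (a version of) the conditional velocity v(t,x) = E[dX_t/dt | X_t = x]: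
  jointly measurable, and for a.e. t in [0,1] the velocity exists a.s., is integrable,
  and v(t,X_t) is the conditional expectation of it given X_t.\<close>
definition cond_velocity :: "'w measure \<Rightarrow> (real \<Rightarrow> 'w \<Rightarrow> 'a::euclidean_space) \<Rightarrow> (real \<Rightarrow> 'a \<Rightarrow> 'a) \<Rightarrow> bool" where
  "cond_velocity M X v \<longleftrightarrow>
     (\<lambda>(t, x). v t x) \<in> borel_measurable (restrict_space borel ({0..1} \<times> UNIV)) \<and>
     (AE t in lborel. t \<in> {0..1} \<longrightarrow>
        (AE \<omega> in M. (\<lambda>s. X s \<omega>) differentiable (at t within {0..1})) \<and>
        integrable M (path_velocity X t) \<and>
        integrable M (\<lambda>\<omega>. v t (X t \<omega>)) \<and>
        (\<forall>A\<in>sets borel.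
           (LINT \<omega>:{\<omega>\<in>space M. X t \<omega> \<in> A}|M. path_velocity X t \<omega>) =
           (LINT \<omega>:{\<omega>\<in>space M. X t \<omega> \<in> A}|M. v t (X t \<omega>))))"

definition is_flow :: "(real \<Rightarrow> 'a::real_normed_vector \<Rightarrow> 'a) \<Rightarrow> (real \<Rightarrow> 'a \<Rightarrow> 'a) \<Rightarrow> bool" where
  "is_flow v \<phi> \<longleftrightarrow> (\<forall>x. \<phi> 0 x = x \<and>
     (\<forall>t\<in>{0..1}. ((\<lambda>s. \<phi> s x) has_vector_derivative v t (\<phi> t x)) (at t within {0..1})))"

definition in_S_SL :: "'w measure \<Rightarrow> (real \<Rightarrow> 'w \<Rightarrow> 'a::euclidean_space) \<Rightarrow> 'a measure \<Rightarrow> 'a measure \<Rightarrow> bool" where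
  "in_S_SL M X P0 P1 \<longleftrightarrow>
     absolutely_continuous lborel P0 \<and> absolutely_continuous lborel P1 \<and>
     in_S M X P0 P1 \<and>
     (\<exists>v. cond_velocity M X v \<and>
        (\<exists>L. \<forall>t\<in>{0..1}. lipschitz_on L UNIV (v t)) \<and>
        (\<exists>\<phi>. is_flow v \<phi>) \<and>
        (\<forall>\<phi>. is_flow v \<phi> \<longrightarrow>
           (\<forall>t\<in>{0..1}. \<forall>x. ((\<lambda>s. v s (\<phi> s x)) has_vector_derivative 0) (at t within {0..1}))))"

definition in_F_SL ::
  "real \<Rightarrow> (real \<Rightarrow> 'a::euclidean_space \<Rightarrow> 'a \<Rightarrow> 'b::euclidean_space \<Rightarrow> 'a) \<Rightarrow> 'b measure \<Rightarrow>
   'a measure \<Rightarrow> 'a measure \<Rightarrow> bool" where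
  "in_F_SL p F Q P0 P1 \<longleftrightarrow> gen_interp p F Q \<and>
     in_S_SL (P0 \<Otimes>\<^sub>M (P1 \<Otimes>\<^sub>M Q)) (induced_process F) P0 P1"

end

theory Submission
  imports Defs
begin

text \<open>
  Simultaneous diagonalisation gives \<open>\<Sigma>\<^sub>0 = V V\<^sup>T\<close> and \<open>\<Sigma>\<^sub>1 = V diag(s\<^sup>2) V\<^sup>T\<close>, and
  \<open>\<Sigma>\<^sub>Z = V diag(s) V\<^sup>T\<close> is chosen so that \<open>Cov X\<^sub>t = V diag((1 - t) + t s)\<^sup>2 V\<^sup>T\<close> is a perfect square.
  In the coordinates \<open>V\<^sup>-\<^sup>1\<close> the conditional velocity is then linear with rates \<open>(s - 1) / ((1 - t) + t s)\<close>,
  and its flow lines are straight. That this is the conditional expectation is seen without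
  computing conditional laws: the Gaussian law of \<open>(X\<^sub>0, X\<^sub>1, Z)\<close> is invariant under the reflection
  that fixes the linear regression on \<open>X\<^sub>t\<close> and negates its complement; it preserves
  \<open>X\<^sub>t\<close> and changes the sign of the derivative of \<open>X\<close> minus \<open>v(t, X\<^sub>t)\<close>, so the latter integrates to
  \<open>0\<close> over every event \<open>X\<^sub>t \<in> A\<close>.
\<close>

section \<open>Simultaneous diagonalisation\<close>

text \<open>The factor 2t(1-t) supplies exactly the missing cross term: in coordinate i the
  variances 1, s^2, s of the three inputs combine to (1-t)^2 + t^2 s^2 + 2t(1-t) s = ((1-t) + ts)^2.
  The regression coefficient of the path velocity on X_t is half the logarithmic derivative of this
  variance, hence the logarithmic derivative of (1-t) + ts; this is where the rates come from. The
  endpoints are the obstacle. The derivative of sqrt(2t(1-t)) grows like t^(-1/2) at 0 and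
  (1-t)^(-1/2) at 1, so its p-th power is integrable for p < 2, and differentiability of paths is
  claimed only for 0 < t < 1. The velocity field itself stays regular on the closed interval,
  because (1-t) + ts is at least min 1 s. Invariance of the Gaussian law under the reflection splits
  into two facts: the joint density depends on the point only through one quadratic form per
  coordinate, which the reflection preserves, and Lebesgue measure is preserved because the
  reflection is assembled from shears and point reflections of fibres.\<close>

definition diag_mat :: "('n \<Rightarrow> real) \<Rightarrow> real^'n^'n" where
  "diag_mat d = (\<chi> i j. if i = j then d i else 0)"

lemma diag_mat_mult_vec: "diag_mat d *v x = (\<chi> i. d i * x $ i)"
  by (simp add: diag_mat_def matrix_vector_mult_def vec_eq_iff if_distrib[of "\<lambda>a. a * _"] cong: if_cong)

lemma diag_mat_mult: "diag_mat c ** diag_mat d = diag_mat (\<lambda>i. c i * d i)"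
  by (simp add: diag_mat_def matrix_matrix_mult_def vec_eq_iff if_distrib[of "\<lambda>a. a * _"] cong: if_cong)

lemma transpose_diag_mat [simp]: "transpose (diag_mat d) = diag_mat d"
  by (simp add: diag_mat_def transpose_def vec_eq_iff)

lemma diag_mat_one: "diag_mat (\<lambda>_. 1) = mat 1"
  by (simp add: diag_mat_def mat_def)

lemma diagonal_diag_mat: "diagonal_mat (diag_mat d)"
  by (simp add: diag_mat_def diagonal_mat_def)

lemma diag_sqrt_diag_mat: "diag_sqrt (diag_mat d) = diag_mat (\<lambda>i. sqrt (d i))"
  by (simp add: diag_mat_def diag_sqrt_def vec_eq_iff)

lemma pos_def_congruence:
  fixes V W :: "real^'n^'n"
  assumes VW: "V ** W = mat 1" and d: "\<And>i. 0 < d i"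
  shows "pos_def_mat (V ** diag_mat d ** transpose V)"
  unfolding pos_def_mat_def
proof (intro conjI allI impI)
  show "transpose (V ** diag_mat d ** transpose V) = V ** diag_mat d ** transpose V"
    by (simp add: matrix_transpose_mul matrix_mul_assoc)
  fix x :: "real^'n" assume "x \<noteq> 0"
  let ?y = "transpose V *v x"
  have "?y \<noteq> 0"
  proof
    assume "?y = 0"
    then have "transpose W *v (transpose V *v x) = 0" by simp
    moreover have "transpose W ** transpose V = mat 1"
      by (metis VW matrix_transpose_mul transpose_mat)
    ultimately show False using \<open>x \<noteq> 0\<close>
      by (simp only: matrix_vector_mul_assoc matrix_vector_mul_lid)
  qed
  then obtain i where "?y $ i \<noteq> 0" by (metis vec_eq_iff zero_index)
  then have "0 < (\<Sum>i\<in>UNIV. d i * (?y $ i)\<^sup>2)"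
    by (intro sum_pos2[of _ i]) (auto simp: d mult_nonneg_nonneg less_imp_le)
  also have "\<dots> = ?y \<bullet> (diag_mat d *v ?y)"
    by (simp add: diag_mat_mult_vec inner_vec_def power2_eq_square ac_simps)
  also have "\<dots> = x \<bullet> ((V ** diag_mat d ** transpose V) *v x)"
    by (simp add: matrix_vector_mul_assoc[symmetric] dot_lmul_matrix[symmetric] vector_transpose_matrix
        flip: transpose_matrix_vector)
  finally show "0 < x \<bullet> ((V ** diag_mat d ** transpose V) *v x)" .
qed

lemma symmetric_dot:
  fixes S :: "real^'n^'n"
  assumes "transpose S = S"
  shows "x \<bullet> (S *v y) = y \<bullet> (S *v x)"
  by (metis assms dot_lmul_matrix inner_commute transpose_matrix_vector)

text \<open>A maximiser \<open>u\<close> of the generalised Rayleigh quotient over the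
  \<open>S0\<close>-orthogonal complement of \<open>B\<close> is the new eigenvector. Its
  first-order condition tests only directions in that complement; the directions in \<open>B\<close>
  are covered because they are eigenvectors already.\<close>

lemma generalized_eigenvector_extend:
  fixes S0 S1 :: "real^'n^'n"
  assumes S0: "pos_def_mat S0" and S1: "pos_def_mat S1"
    and B: "finite B" "card B < CARD('n)"
    and orth: "\<And>a b. a \<in> B \<Longrightarrow> b \<in> B \<Longrightarrow> a \<bullet> (S0 *v b) = (if a = b then 1 else 0)"
    and eig: "\<And>b. b \<in> B \<Longrightarrow> \<exists>l. S1 *v b = l *\<^sub>R (S0 *v b)"
  shows "\<exists>u l. (\<forall>b\<in>B. b \<bullet> (S0 *v u) = 0) \<and> u \<bullet> (S0 *v u) = 1 \<and> S1 *v u = l *\<^sub>R (S0 *v u)"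
proof -
  have sym0: "x \<bullet> (S0 *v y) = y \<bullet> (S0 *v x)" and sym1: "x \<bullet> (S1 *v y) = y \<bullet> (S1 *v x)" for x y
    using S0 S1 by (auto simp: pos_def_mat_def intro: symmetric_dot)
  have pos0: "0 < x \<bullet> (S0 *v x)" if "x \<noteq> 0" for x
    using S0 that by (auto simp: pos_def_mat_def)
  define W where "W = {w. \<forall>b\<in>B. b \<bullet> (S0 *v w) = 0}"
  have W_scale: "c *\<^sub>R w \<in> W" and W_add: "w + w' \<in> W" if "w \<in> W" "w' \<in> W" for c w w'
    using that by (auto simp: W_def matrix_vector_mult_scaleR matrix_vector_right_distrib inner_add_right)
  \<comment> \<open>Fewer than \<open>CARD('n)\<close> vectors \<open>S0 *v b\<close> cannot span
    the space, and by symmetry of \<open>S0\<close> a vector orthogonal to all of them lies in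
    \<open>W\<close>. So the set to be maximised over is nonempty.\<close>
  have "dim ((\<lambda>b. S0 *v b) ` B) < DIM(real^'n)"
    using dim_le_card[of "(\<lambda>b. S0 *v b) ` B" "(\<lambda>b. S0 *v b) ` B"] card_image_le[OF B(1), of "\<lambda>b. S0 *v b"] B
    by (auto simp: span_superset)
  then obtain w0 where "w0 \<noteq> 0" "\<And>y. y \<in> span ((\<lambda>b. S0 *v b) ` B) \<Longrightarrow> orthogonal w0 y"
    using orthogonal_to_subspace_exists by blast
  then have w0: "w0 \<noteq> 0" "w0 \<in> W"
    using sym0[of _ w0] by (auto simp: W_def orthogonal_def intro!: span_base)
  let ?K = "W \<inter> sphere 0 1"
  have "closed W"
    unfolding W_def Ball_def
    by (intro closed_Collect_all closed_Collect_imp closed_Collect_eq continuous_intros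
        matrix_vector_mult_linear_continuous_on) auto
  then have "compact ?K" by (simp add: closed_Int_compact)
  moreover have "?K \<noteq> {}"
    using W_scale[OF w0(2,2), of "1 / norm w0"] w0 by (auto intro!: exI[of _ "(1 / norm w0) *\<^sub>R w0"])
  moreover have "w \<bullet> (S0 *v w) \<noteq> 0" if "w \<in> ?K" for w
  proof -
    have "w \<noteq> 0" using that by auto
    then show ?thesis using pos0[of w] by simp
  qed
  then have "continuous_on ?K (\<lambda>w. w \<bullet> (S1 *v w) / (w \<bullet> (S0 *v w)))"
    by (intro continuous_intros matrix_vector_mult_linear_continuous_on) blast
  ultimately obtain u where u: "u \<in> ?K" and
    max: "\<And>w. w \<in> ?K \<Longrightarrow> w \<bullet> (S1 *v w) / (w \<bullet> (S0 *v w)) \<le> u \<bullet> (S1 *v u) / (u \<bullet> (S0 *v u))"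
    using continuous_attains_sup[of ?K] by blast
  define l where "l = u \<bullet> (S1 *v u) / (u \<bullet> (S0 *v u))"
  have u0: "u \<noteq> 0" "u \<in> W" using u by auto
  \<comment> \<open>\<open>q\<close> is the bilinear form of \<open>S1 - l S0\<close>. Maximality of
    \<open>l\<close> makes \<open>q w w\<close> nonpositive on \<open>W\<close>, with value 0 at
    \<open>u\<close>; the aim is that \<open>u\<close> lies in the kernel of
    \<open>q\<close>.\<close>
  define q where "q x y = x \<bullet> (S1 *v y) - l * (x \<bullet> (S0 *v y))" for x y
  have q_sym: "q x y = q y x" for x y by (simp add: q_def sym0[of x] sym1[of x])
  have q_add: "q (x + y) z = q x z + q y z" and q_scale: "q (c *\<^sub>R x) z = c * q x z"  for x y z c
    by (simp_all add: q_def inner_add_left algebra_simps)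
  have q_add': "q z (x + y) = q z x + q z y" and q_scale': "q z (c *\<^sub>R x) = c * q z x" for x y z c
    by (simp_all add: q_sym[of z] q_add q_scale)
  have q_uu: "q u u = 0" using pos0[OF u0(1)] by (simp add: q_def l_def)
  have q_le: "q w w \<le> 0" if w: "w \<in> W" for w
  proof (cases "w = 0")
    case False
    let ?c = "1 / norm w"
    have "?c *\<^sub>R w \<in> ?K" using False W_scale[OF w w] by auto
    from max[OF this] have "w \<bullet> (S1 *v w) / (w \<bullet> (S0 *v w)) \<le> l"
      using False by (simp add: l_def matrix_vector_mult_scaleR)
    then show ?thesis using pos0[OF False] by (simp add: q_def field_simps)
  qed (simp add: q_def)
  have q_W: "q w u = 0" if w: "w \<in> W" for w
  proof (rule ccontr)
    assume ne: "q w u \<noteq> 0"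
    have ineq: "2 * e * q w u + e\<^sup>2 * q w w \<le> 0" for e
    proof -
      have "q (u + e *\<^sub>R w) (u + e *\<^sub>R w) \<le> 0"
        by (intro q_le W_add[OF u0(2)] W_scale[OF w w])
      then show ?thesis
        by (simp add: q_add q_scale q_add' q_scale' q_uu q_sym[of u w] power2_eq_square algebra_simps)
    qed
    \<comment> \<open>Since \<open>m\<close> exceeds \<open>- q w w\<close>, the step
      \<open>e = q w u / m\<close> is short enough for the linear gain to outweigh the quadratic
      loss, contradicting \<open>ineq\<close>.\<close>
    define m where "m = 1 + \<bar>q w w\<bar>"
    have m: "0 < m" "- q w w < m" by (auto simp: m_def)
    have "2 * (q w u / m) * q w u + (q w u / m)\<^sup>2 * q w w = (q w u)\<^sup>2 / m\<^sup>2 * (2 * m + q w w)"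
      using m by (simp add: field_simps power2_eq_square)
    moreover have "\<dots> > 0" using ne m by (intro mult_pos_pos) auto
    ultimately show False using ineq[of "q w u / m"] by simp
  qed
  have q_B: "q b u = 0" if b: "b \<in> B" for b
  proof -
    obtain lb where "S1 *v b = lb *\<^sub>R (S0 *v b)" using eig[OF b] by blast
    then have "u \<bullet> (S1 *v b) = lb * (u \<bullet> (S0 *v b))" by simp
    moreover have "u \<bullet> (S0 *v b) = 0" using u0(2) b sym0 by (simp add: W_def)
    ultimately show ?thesis by (simp add: q_def sym0[of b] sym1[of b])
  qed
  have q_all: "q x u = 0" for x
  proof -
    \<comment> \<open>\<open>y\<close> is the \<open>S0\<close>-orthogonal projection of
      \<open>x\<close> onto the span of \<open>B\<close>, so \<open>x - y\<close> falls under
      \<open>q_W\<close> and \<open>y\<close> under \<open>q_B\<close>.\<close>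
    define y where "y = (\<Sum>b\<in>B. (b \<bullet> (S0 *v x)) *\<^sub>R b)"
    have "x - y \<in> W"
      unfolding W_def
    proof safe
      fix a assume a: "a \<in> B"
      have "a \<bullet> (S0 *v y) = (\<Sum>b\<in>B. (b \<bullet> (S0 *v x)) * (a \<bullet> (S0 *v b)))"
        by (simp add: y_def linear_sum[OF matrix_vector_mul_linear] matrix_vector_mult_scaleR inner_sum_right)
      also have "\<dots> = (\<Sum>b\<in>B. if a = b then b \<bullet> (S0 *v x) else 0)"
        using a by (intro sum.cong) (auto simp: orth)
      also have "\<dots> = a \<bullet> (S0 *v x)" using a B by simp
      finally show "a \<bullet> (S0 *v (x - y)) = 0"
        by (simp add: matrix_vector_mult_diff_distrib inner_diff_right)
    qed
    moreover have "q y u = 0"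
    proof -
      have "q (\<Sum>b\<in>C. (b \<bullet> (S0 *v x)) *\<^sub>R b) u = 0" if "finite C" "C \<subseteq> B" for C
        using that by induction (auto simp: q_add q_scale q_B, simp add: q_def)
      then show ?thesis using B by (simp add: y_def)
    qed
    ultimately have "q ((x - y) + y) u = 0" by (simp only: q_add q_W)
    then show ?thesis by simp
  qed
  have eigu: "S1 *v u = l *\<^sub>R (S0 *v u)"
  proof -
    \<comment> \<open>Testing \<open>q_all\<close> against the residual vector itself shows that its
      norm is 0.\<close>
    have "(S1 *v u - l *\<^sub>R (S0 *v u)) \<bullet> (S1 *v u - l *\<^sub>R (S0 *v u)) = 0"
      using q_all[of "S1 *v u - l *\<^sub>R (S0 *v u)"] by (simp add: q_def inner_diff_right)
    then show ?thesis by simp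
  qed
  let ?u = "(1 / sqrt (u \<bullet> (S0 *v u))) *\<^sub>R u"
  have "?u \<bullet> (S0 *v ?u) = 1"
    using pos0[OF u0(1)] by (simp add: matrix_vector_mult_scaleR)
  moreover have "S1 *v ?u = l *\<^sub>R (S0 *v ?u)" by (simp add: matrix_vector_mult_scaleR eigu)
  moreover have "\<forall>b\<in>B. b \<bullet> (S0 *v ?u) = 0"
    using u0(2) by (simp add: W_def matrix_vector_mult_scaleR)
  ultimately show ?thesis by blast
qed

text \<open>The induction is on the size \<open>k\<close> of an \<open>S0\<close>-orthonormal family
  of eigenvectors, which can be enlarged as long as \<open>k\<close> is below the dimension.\<close>

lemma generalized_eigenbasis:
  fixes S0 S1 :: "real^'n^'n"
  assumes S0: "pos_def_mat S0" and S1: "pos_def_mat S1"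
  shows "\<exists>B. finite B \<and> card B = CARD('n) \<and>
    (\<forall>a\<in>B. \<forall>b\<in>B. a \<bullet> (S0 *v b) = (if a = b then 1 else 0)) \<and>
    (\<forall>b\<in>B. \<exists>l. S1 *v b = l *\<^sub>R (S0 *v b))"
proof -
  have "k \<le> CARD('n) \<Longrightarrow> \<exists>B. finite B \<and> card B = k \<and>
    (\<forall>a\<in>B. \<forall>b\<in>B. a \<bullet> (S0 *v b) = (if a = b then 1 else 0)) \<and>
    (\<forall>b\<in>B. \<exists>l. S1 *v b = l *\<^sub>R (S0 *v b))" for k
  proof (induction k)
    case 0 then show ?case by (intro exI[of _ "{}"]) auto
  next
    case (Suc k)
    then obtain B where B: "finite B" "card B = k"
      and orth: "\<And>a b. a \<in> B \<Longrightarrow> b \<in> B \<Longrightarrow> a \<bullet> (S0 *v b) = (if a = b then 1 else 0)"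
      and eig: "\<And>b. b \<in> B \<Longrightarrow> \<exists>l. S1 *v b = l *\<^sub>R (S0 *v b)" by (auto simp: Suc_le_eq)
    obtain u l where u: "\<And>b. b \<in> B \<Longrightarrow> b \<bullet> (S0 *v u) = 0" "u \<bullet> (S0 *v u) = 1"
        "S1 *v u = l *\<^sub>R (S0 *v u)"
      using generalized_eigenvector_extend[OF S0 S1 B(1) _ orth eig] Suc.prems B(2) by auto
    have u': "u \<bullet> (S0 *v b) = 0" if "b \<in> B" for b
      using u(1)[OF that] S0 symmetric_dot by (metis pos_def_mat_def)
    have "u \<notin> B" using u by force
    then show ?case
      using B orth eig u u' by (intro exI[of _ "insert u B"]) auto
  qed
  then show ?thesis by blast
qed

text \<open>Congruence by the matrix \<open>W\<close> whose rows are the eigenvectors turns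
  \<open>S0\<close> into the identity and \<open>S1\<close> into a diagonal matrix; undoing it by
  the inverse \<open>V\<close> yields both factorisations at once.\<close>

lemma simultaneous_diagonalization:
  fixes S0 S1 :: "real^'n^'n"
  assumes S0: "pos_def_mat S0" and S1: "pos_def_mat S1"
  obtains V W :: "real^'n^'n" and d :: "'n \<Rightarrow> real"
  where "V ** W = mat 1" "W ** V = mat 1" "\<And>i. 0 < d i"
    "S0 = V ** transpose V" "S1 = V ** diag_mat d ** transpose V"
proof -
  obtain B where B: "finite B" "card B = CARD('n)"
    and orth: "\<And>a b. a \<in> B \<Longrightarrow> b \<in> B \<Longrightarrow> a \<bullet> (S0 *v b) = (if a = b then 1 else 0)"
    and eig: "\<And>b. b \<in> B \<Longrightarrow> \<exists>l. S1 *v b = l *\<^sub>R (S0 *v b)"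
    using generalized_eigenbasis[OF S0 S1] by metis
  obtain h :: "'n \<Rightarrow> real^'n" where h: "bij_betw h UNIV B"
    using B finite_same_card_bij[of "UNIV :: 'n set" B] by auto
  have hB: "h i \<in> B" for i using h by (auto simp: bij_betw_def)
  have orth': "h i \<bullet> (S0 *v h j) = (if i = j then 1 else 0)" for i j
    using orth[OF hB hB, of i j] h by (auto simp: bij_betw_def inj_on_def)
  obtain d where d: "\<And>i. S1 *v h i = d i *\<^sub>R (S0 *v h i)" using eig[OF hB] by metis
  have dpos: "0 < d i" for i
  proof -
    have "h i \<noteq> 0" using orth'[of i i] by auto
    then have "0 < h i \<bullet> (S1 *v h i)" using S1 by (auto simp: pos_def_mat_def)
    also have "\<dots> = d i" by (simp add: d orth')
    finally show ?thesis .
  qed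
  define W :: "real^'n^'n" where "W = (\<chi> i. h i)"
  have cong: "W ** S ** transpose W = (\<chi> i j. h i \<bullet> (S *v h j))" for S :: "real^'n^'n"
  proof -
    have "(W ** S ** transpose W) $ i $ j = h i \<bullet> (S *v h j)" for i j
      unfolding matrix_mul_assoc[symmetric]
      by (simp add: W_def matrix_matrix_mult_def matrix_vector_mult_def transpose_def inner_vec_def)
    then show ?thesis by (simp add: vec_eq_iff)
  qed
  have W0: "W ** S0 ** transpose W = mat 1" by (simp add: cong orth' mat_def vec_eq_iff)
  have W1: "W ** S1 ** transpose W = diag_mat d" by (simp add: cong orth' d diag_mat_def vec_eq_iff)
  \<comment> \<open>The identity \<open>W0\<close> already exhibits this product as a right inverse
    of \<open>W\<close>.\<close>
  define V where "V = S0 ** transpose W"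
  have WV: "W ** V = mat 1" using W0 by (simp add: V_def matrix_mul_assoc)
  then have VW: "V ** W = mat 1" by (simp add: matrix_left_right_inverse)
  have VtWt: "transpose W ** transpose V = mat 1"
    by (metis VW matrix_transpose_mul transpose_mat)
  have rec: "V ** (W ** S ** transpose W) ** transpose V = S" for S
  proof -
    have "V ** (W ** S ** transpose W) ** transpose V = (V ** W) ** S ** (transpose W ** transpose V)"
      by (simp only: matrix_mul_assoc)
    then show ?thesis by (simp add: VW VtWt)
  qed
  show thesis
  proof
    show "V ** W = mat 1" "W ** V = mat 1" "\<And>i. 0 < d i" by fact+
    show "S0 = V ** transpose V" using rec[of S0] by (simp add: W0)
    show "S1 = V ** diag_mat d ** transpose V" using rec[of S1] by (simp add: W1)
  qed
qed

section \<open>Linear change of variables and Gaussian measures\<close>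

lemma nn_integral_lborel_translate:
  fixes h :: "'a::euclidean_space \<Rightarrow> ennreal"
  assumes [measurable]: "h \<in> borel_measurable borel"
  shows "(\<integral>\<^sup>+x. h (m + x) \<partial>lborel) = (\<integral>\<^sup>+x. h x \<partial>lborel)"
  by (subst (2) lborel_distr_plus[of m, symmetric]) (simp add: nn_integral_distr)

text \<open>The displacement is along \<open>i\<close> and, by \<open>g_inv\<close>, constant on
  each line in that direction. Splitting off coordinate \<open>i\<close> by Tonelli leaves a
  one-dimensional translation in the inner integral.\<close>

lemma nn_integral_lborel_shear_Basis:
  fixes h :: "'a::euclidean_space \<Rightarrow> ennreal"
  assumes i: "i \<in> Basis" and h [measurable]: "h \<in> borel_measurable borel"
    and g [measurable]: "g \<in> borel_measurable borel" and g_inv: "\<And>x c. g (x + c *\<^sub>R i) = g x"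
  shows "(\<integral>\<^sup>+x. h (x + g x *\<^sub>R i) \<partial>lborel) = (\<integral>\<^sup>+x. h x \<partial>lborel)"
proof -
  interpret product_sigma_finite "\<lambda>_::'a. lborel :: real measure" ..
  define I where "I = Basis - {i}"
  have I: "finite I" "i \<notin> I" "Basis = insert i I" using i by (auto simp: I_def)
  define S where "S x = (\<Sum>b\<in>I. x b *\<^sub>R b)" for x :: "'a \<Rightarrow> real"
  have split: "(\<Sum>b\<in>Basis. (x(i := y)) b *\<^sub>R b) = y *\<^sub>R i + S x" for x y
    unfolding I(3) S_def using I(1,2) by (subst sum.insert) (auto intro!: sum.cong)
  have unfold: "(\<integral>\<^sup>+x. k x \<partial>lborel) =
      (\<integral>\<^sup>+x. (\<integral>\<^sup>+y. k (y *\<^sub>R i + S x) \<partial>lborel) \<partial>Pi\<^sub>M I (\<lambda>_. lborel))"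
    if [measurable]: "k \<in> borel_measurable borel" for k :: "'a \<Rightarrow> ennreal"
  proof -
    have "(\<integral>\<^sup>+x. k x \<partial>lborel) = (\<integral>\<^sup>+x. k (\<Sum>b\<in>Basis. x b *\<^sub>R b) \<partial>Pi\<^sub>M Basis (\<lambda>_. lborel))"
      by (subst lborel_eq) (simp add: nn_integral_distr)
    also have "\<dots> = (\<integral>\<^sup>+x. (\<integral>\<^sup>+y. k (\<Sum>b\<in>Basis. (x(i := y)) b *\<^sub>R b) \<partial>lborel) \<partial>Pi\<^sub>M I (\<lambda>_. lborel))"
      by (subst (1) I(3), rule product_nn_integral_insert[OF I(1,2)]) (simp add: I(3)[symmetric])
    finally show ?thesis by (simp only: split)
  qed
  have "(\<integral>\<^sup>+y. h (y *\<^sub>R i + S x + g (y *\<^sub>R i + S x) *\<^sub>R i) \<partial>lborel) = (\<integral>\<^sup>+y. h (y *\<^sub>R i + S x) \<partial>lborel)" for x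
  proof -
    have "g (y *\<^sub>R i + S x) = g (S x)" for y using g_inv[of "S x" y] by (simp add: add.commute)
    then have "(\<integral>\<^sup>+y. h (y *\<^sub>R i + S x + g (y *\<^sub>R i + S x) *\<^sub>R i) \<partial>lborel) =
        (\<integral>\<^sup>+y. h ((g (S x) + y) *\<^sub>R i + S x) \<partial>lborel)"
      by (simp add: algebra_simps)
    also have "\<dots> = (\<integral>\<^sup>+y. h (y *\<^sub>R i + S x) \<partial>lborel)"
      by (rule nn_integral_lborel_translate[of "\<lambda>y. h (y *\<^sub>R i + S x)" "g (S x)"]) simp
    finally show ?thesis .
  qed
  then show ?thesis by (simp add: unfold)
qed

lemma nn_integral_lborel_add_coordinate:
  fixes h :: "real^'n \<Rightarrow> ennreal"
  assumes "m \<noteq> n" and [measurable]: "h \<in> borel_measurable borel"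
  shows "(\<integral>\<^sup>+x. h (\<chi> i. if i = m then x $ m + c * x $ n else x $ i) \<partial>lborel) = (\<integral>\<^sup>+x. h x \<partial>lborel)"
proof -
  have "(\<chi> i. if i = m then x $ m + c * x $ n else x $ i) = x + (c * x $ n) *\<^sub>R axis m 1" for x :: "real^'n"
    by (simp add: vec_eq_iff axis_def)
  moreover have "axis m 1 \<in> (Basis :: (real^'n) set)" "axis m 1 $ n = (0::real)"
    using assms by (auto simp: Basis_vec_def axis_def)
  ultimately show ?thesis
    using nn_integral_lborel_shear_Basis[of "axis m 1" h "\<lambda>x. c * x $ n"] by simp
qed

lemma nn_integral_lborel_stretch:
  fixes h :: "real^'n \<Rightarrow> ennreal"
  assumes c: "\<And>i. c i \<noteq> 0" and [measurable]: "h \<in> borel_measurable borel"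
  shows "(\<integral>\<^sup>+x. h x \<partial>lborel) = ennreal \<bar>\<Prod>i\<in>UNIV. c i\<bar> * (\<integral>\<^sup>+x. h (\<chi> i. c i * x $ i) \<partial>lborel)"
proof -
  \<comment> \<open>\<open>c'\<close> re-indexes the factors \<open>c\<close> by basis vectors
    instead of by component indices.\<close>
  define c' where "c' b = (\<Sum>i\<in>UNIV. c i * b $ i)" for b :: "real^'n"
  have c': "c' (axis i 1) = c i" for i
    by (simp add: c'_def axis_def if_distrib[of "\<lambda>a. _ * a"] cong: if_cong)
  have bij: "bij_betw (\<lambda>i. axis i 1) UNIV (Basis :: (real^'n) set)"
    by (auto simp: bij_betw_def Basis_vec_def inj_on_def axis_eq_axis)
  have "(\<chi> i. c i * x $ i) = 0 + (\<Sum>b\<in>Basis. (c' b * (x \<bullet> b)) *\<^sub>R b)" for x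
  proof -
    have "(\<Sum>b\<in>Basis. (c' b * (x \<bullet> b)) *\<^sub>R b) = (\<Sum>i\<in>UNIV. (c i * x $ i) *\<^sub>R axis i 1)"
      by (subst sum.reindex_bij_betw[OF bij, symmetric]) (simp add: c' inner_axis)
    then show ?thesis
      by (simp add: vec_eq_iff axis_def if_distrib[of "\<lambda>a. _ * a"] cong: if_cong)
  qed
  moreover have "(\<Prod>b\<in>Basis. \<bar>c' b\<bar>) = \<bar>\<Prod>i\<in>UNIV. c i\<bar>"
    by (subst prod.reindex_bij_betw[OF bij, symmetric]) (simp add: c' abs_prod)
  moreover have "c' b \<noteq> 0" if "b \<in> Basis" for b
    using that c c' unfolding bij_betw_imp_surj_on[OF bij, symmetric] by auto
  ultimately show ?thesis
    by (subst lborel_affine_euclidean[where c=c' and t=0])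
      (simp_all add: nn_integral_density nn_integral_distr nn_integral_cmult)
qed

text \<open>An exchange of two coordinates is a sign change \<open>D\<close> followed by three
  elementary shears \<open>E\<close>, and each of the four maps preserves Lebesgue measure.\<close>

lemma nn_integral_lborel_swap:
  fixes h :: "real^'n \<Rightarrow> ennreal"
  assumes "m \<noteq> n" and [measurable]: "h \<in> borel_measurable borel"
  shows "(\<integral>\<^sup>+x. h (\<chi> i. x $ Transposition.transpose m n i) \<partial>lborel) = (\<integral>\<^sup>+x. h x \<partial>lborel)"
proof -
  define E where "E m n c x = (\<chi> i. if i = m then x $ m + c * x $ n else x $ i)" for m n c and x :: "real^'n"
  have [measurable]: "E m n c \<in> borel_measurable borel" for m n c
  proof -
    have "continuous_on UNIV (\<lambda>x::real^'n. if i = m then x $ m + c * x $ n else x $ i)" for i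
      by (cases "i = m") (auto intro!: continuous_intros)
    then show ?thesis
      unfolding E_def by (intro borel_measurable_continuous_onI continuous_on_vec_lambda)
  qed
  have E: "(\<integral>\<^sup>+x. k (E m n c x) \<partial>lborel) = (\<integral>\<^sup>+x. k x \<partial>lborel)"
    if "m \<noteq> n" "k \<in> borel_measurable borel" for m n c k
    unfolding E_def using that by (rule nn_integral_lborel_add_coordinate)
  define D where "D x = (\<chi> i. (if i = m then -1 else 1) * x $ i)" for x :: "real^'n"
  have D: "(\<integral>\<^sup>+x. k (D x) \<partial>lborel) = (\<integral>\<^sup>+x. k x \<partial>lborel)"
    if "k \<in> borel_measurable borel" for k
    using nn_integral_lborel_stretch[of "\<lambda>i. if i = m then -1 else 1" k] that
    by (simp add: D_def abs_prod if_distrib[of abs] cong: if_cong)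
  have "(\<chi> i. x $ Transposition.transpose m n i) = E m n 1 (E n m (-1) (E m n 1 (D x)))" for x
    using \<open>m \<noteq> n\<close> by (auto simp: vec_eq_iff E_def D_def Transposition.transpose_def)
  then have "(\<integral>\<^sup>+x. h (\<chi> i. x $ Transposition.transpose m n i) \<partial>lborel)
      = (\<integral>\<^sup>+x. h (E m n 1 (E n m (-1) (E m n 1 (D x)))) \<partial>lborel)" by simp
  also have "\<dots> = (\<integral>\<^sup>+x. h (E m n 1 (E n m (-1) (E m n 1 x))) \<partial>lborel)"
    by (rule D) measurable
  also have "\<dots> = (\<integral>\<^sup>+x. h (E m n 1 (E n m (-1) x)) \<partial>lborel)"
    using \<open>m \<noteq> n\<close> by (intro E) auto
  also have "\<dots> = (\<integral>\<^sup>+x. h (E m n 1 x) \<partial>lborel)"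
    using \<open>m \<noteq> n\<close> by (intro E) auto
  also have "\<dots> = (\<integral>\<^sup>+x. h x \<partial>lborel)"
    using \<open>m \<noteq> n\<close> by (intro E) auto
  finally show ?thesis .
qed

lemma borel_measurable_matrix_vector_mult [measurable]:
  "(\<lambda>x. (A :: real^'n^'m) *v x) \<in> borel_measurable borel"
  by (intro borel_measurable_continuous_onI matrix_vector_mult_linear_continuous_on)

text \<open>The library proves the linear change of variables only for well-ordered index types.\<close>

lemma nn_integral_lborel_matrix:
  fixes A :: "real^'n^'n"
  assumes "det A \<noteq> 0" and "h \<in> borel_measurable borel"
  shows "(\<integral>\<^sup>+x. h x \<partial>lborel) = ennreal \<bar>det A\<bar> * (\<integral>\<^sup>+x. h (A *v x) \<partial>lborel)"
proof -
  \<comment> \<open>Both the determinant condition and the quantifier over \<open>h\<close> belong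
    to the induction statement: the zero-row case becomes vacuous, and the product case uses the
    hypothesis for \<open>B\<close> with \<open>h\<close> composed with \<open>A\<close>.\<close>
  have "det A \<noteq> 0 \<longrightarrow> (\<forall>h\<in>borel_measurable borel.
    (\<integral>\<^sup>+x. h x \<partial>lborel) = ennreal \<bar>det A\<bar> * (\<integral>\<^sup>+x. h (A *v x) \<partial>lborel))"
  proof (induction A rule: induct_matrix_elementary_alt)
    case (1 A B)
    show ?case
    proof (intro impI ballI)
      fix h :: "real^'n \<Rightarrow> ennreal" assume "det (A ** B) \<noteq> 0" and h [measurable]: "h \<in> borel_measurable borel"
      then have "det A \<noteq> 0" "det B \<noteq> 0" by (auto simp: det_mul)
      then have "(\<integral>\<^sup>+x. h x \<partial>lborel) = ennreal \<bar>det A\<bar> * (ennreal \<bar>det B\<bar> * (\<integral>\<^sup>+x. h (A *v (B *v x)) \<partial>lborel))"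
        using 1(1)[rule_format, OF _ h] 1(2)[rule_format, of "\<lambda>x. h (A *v x)"] by simp
      then show "(\<integral>\<^sup>+x. h x \<partial>lborel) = ennreal \<bar>det (A ** B)\<bar> * (\<integral>\<^sup>+x. h ((A ** B) *v x) \<partial>lborel)"
        by (simp add: det_mul abs_mult ennreal_mult mult.assoc matrix_vector_mul_assoc)
    qed
  next
    case (2 A i)
    then show ?case using det_zero_row(2)[of i A] by simp
  next
    case (3 A)
    have "A *v x = (\<chi> i. A $ i $ i * x $ i)" for x
    proof -
      have "(\<Sum>j\<in>UNIV. A $ i $ j * x $ j) = A $ i $ i * x $ i" for i
        using 3 by (subst sum.remove[of _ i]) (auto intro!: sum.neutral)
      then show ?thesis by (simp add: matrix_vector_mult_def)
    qed
    then show ?case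
      using det_diagonal[of A] 3 by (auto intro!: nn_integral_lborel_stretch)
  next
    case (4 m n)
    let ?A = "(\<chi> i j. mat 1 $ i $ Transposition.transpose m n j) :: real^'n^'n"
    have "?A *v x = (\<chi> i. x $ Transposition.transpose m n i)" for x
    proof -
      have "(\<Sum>j\<in>UNIV. (if i = Transposition.transpose m n j then 1 else 0) * x $ j)
          = (\<Sum>j\<in>UNIV. if j = Transposition.transpose m n i then x $ j else 0)" for i
        by (intro sum.cong) auto
      then show ?thesis by (simp add: matrix_vector_mult_def mat_def)
    qed
    moreover have "\<bar>det ?A\<bar> = 1"
      by (simp add: det_permute_columns permutes_swap_id sign_swap_id abs_mult 4)
    ultimately show ?case using nn_integral_lborel_swap[OF 4] by simp
  next
    case (5 m n)
    let ?A = "(\<chi> i j. of_bool (i = m \<and> j = n \<or> i = j)) :: real^'n^'n"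
    have "?A *v x = (\<chi> i. if i = m then x $ m + 1 * x $ n else x $ i)" for x
    proof -
      have "(\<Sum>j\<in>UNIV. of_bool (i = m \<and> j = n \<or> i = j) * x $ j)
          = (\<Sum>j\<in>UNIV. (if j = n then if i = m then x $ n else 0 else 0) + (if j = i then x $ i else 0))" for i
        using 5 by (intro sum.cong) auto
      then show ?thesis by (simp add: matrix_vector_mult_def sum.distrib vec_eq_iff)
    qed
    moreover have "det ?A = 1"
    proof -
      have "?A = (\<chi> k. if k = m then row m (mat 1) + 1 *s row n (mat 1) else row k (mat 1))"
        using 5 by (auto simp: vec_eq_iff row_def mat_def)
      then show ?thesis using det_row_operation[OF 5, of "mat 1 :: real^'n^'n" 1] by simp
    qed
    ultimately show ?case using nn_integral_lborel_add_coordinate[OF 5, of _ 1] by simp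
  qed
  with assms show ?thesis by blast
qed

lemma nn_integral_lborel_affine_matrix:
  fixes A :: "real^'n^'n"
  assumes A: "det A \<noteq> 0" and [measurable]: "f \<in> borel_measurable borel"
  shows "(\<integral>\<^sup>+x. f x \<partial>lborel) = ennreal \<bar>det A\<bar> * (\<integral>\<^sup>+x. f (m + A *v x) \<partial>lborel)"
  using nn_integral_lborel_translate[of f m] nn_integral_lborel_matrix[OF A, of "\<lambda>x. f (m + x)"] by simp

text \<open>The integrand factorises over coordinates into unnormalised normal densities. The scale
  \<open>s\<close> is kept general because it is taken as 1 for the normalisation of Gaussian laws
  and as \<open>sqrt 2\<close> for their first moment.\<close>

lemma nn_integral_exp_norm2:
  assumes "0 < s"
  shows "(\<integral>\<^sup>+x. ennreal (exp (- (x \<bullet> x) / (2 * s\<^sup>2))) \<partial>(lborel :: 'a::euclidean_space measure))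
    = ennreal (sqrt (2 * pi * s\<^sup>2) ^ DIM('a))"
proof -
  have "ennreal (exp (- (x \<bullet> x) / (2 * s\<^sup>2))) = (\<Prod>b\<in>Basis. ennreal (exp (- (x \<bullet> b)\<^sup>2 / (2 * s\<^sup>2))))" for x :: 'a
  proof -
    have "- (x \<bullet> x) / (2 * s\<^sup>2) = (\<Sum>b\<in>Basis. - (x \<bullet> b)\<^sup>2 / (2 * s\<^sup>2))"
      by (subst euclidean_inner) (simp add: sum_negf sum_divide_distrib power2_eq_square)
    then show ?thesis by (simp add: exp_sum prod_ennreal)
  qed
  then have "(\<integral>\<^sup>+x. ennreal (exp (- (x \<bullet> x) / (2 * s\<^sup>2))) \<partial>(lborel :: 'a measure))
      = (\<Prod>b\<in>(Basis::'a set). \<integral>\<^sup>+u. ennreal (exp (- u\<^sup>2 / (2 * s\<^sup>2))) \<partial>lborel)"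
    by (simp only:) (subst nn_integral_lborel_prod[where f="\<lambda>b u. ennreal (exp (- u\<^sup>2 / (2 * s\<^sup>2)))"], auto)
  also have "(\<integral>\<^sup>+u. ennreal (exp (- u\<^sup>2 / (2 * s\<^sup>2))) \<partial>lborel)
      = (\<integral>\<^sup>+u. ennreal (sqrt (2 * pi * s\<^sup>2)) * ennreal (normal_density 0 s u) \<partial>lborel)"
    using assms by (intro nn_integral_cong) (simp add: normal_density_def ennreal_mult'[symmetric])
  also have "\<dots> = ennreal (sqrt (2 * pi * s\<^sup>2))"
    using assms by (simp add: nn_integral_cmult nn_integral_eq_integral)
  finally show ?thesis by (simp add: ennreal_power)
qed

section \<open>Gaussian laws with factored covariance: density, total mass, first moment\<close>

lemma matrix_inv_eq:
  fixes A B :: "real^'n^'n"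
  assumes "A ** B = mat 1" "B ** A = mat 1"
  shows "matrix_inv A = B"
  unfolding matrix_inv_def using assms
  by (intro some_equality conjI) (metis matrix_mul_assoc matrix_mul_lid matrix_mul_rid)+

text \<open>The inverse covariance is \<open>transpose W ** W\<close>, so the exponent becomes the
  squared norm of \<open>W *v (x - m)\<close>, and the root of the determinant is
  \<open>\<bar>det V\<bar>\<close>.\<close>

lemma gaussian_density_congruence:
  fixes V W :: "real^'n^'n"
  assumes VW: "V ** W = mat 1"
  shows "gaussian_density m (V ** transpose V) x =
    exp (- ((W *v (x - m)) \<bullet> (W *v (x - m))) / 2) / (sqrt (2 * pi) ^ CARD('n) * \<bar>det V\<bar>)"
proof -
  have WV: "W ** V = mat 1" using VW by (simp add: matrix_left_right_inverse)
  have t: "transpose V ** transpose W = mat 1" "transpose W ** transpose V = mat 1"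
    using VW WV by (metis matrix_transpose_mul transpose_mat)+
  have "V ** transpose V ** (transpose W ** W) = V ** (transpose V ** transpose W) ** W"
    "transpose W ** W ** (V ** transpose V) = transpose W ** (W ** V) ** transpose V"
    by (simp_all only: matrix_mul_assoc)
  then have "matrix_inv (V ** transpose V) = transpose W ** W"
    by (intro matrix_inv_eq) (simp_all add: t VW WV)
  moreover have "y \<bullet> ((transpose W ** W) *v y) = (W *v y) \<bullet> (W *v y)" for y
    by (metis dot_lmul_matrix matrix_vector_mul_assoc transpose_matrix_vector transpose_transpose)
  ultimately show ?thesis
    by (simp add: gaussian_density_def det_mul real_sqrt_mult real_sqrt_power power_mult_distrib)
qed

lemma borel_measurable_gaussian_density [measurable]: "gaussian_density m S \<in> borel_measurable borel"
proof -
  have "continuous_on UNIV (\<lambda>x. gaussian_density m S x)"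
  proof (cases "sqrt ((2 * pi) ^ CARD('a) * det S) = 0")
    \<comment> \<open>Division by 0 has the value 0, so a degenerate normaliser makes the density
      constantly 0.\<close>
    case True then show ?thesis by (simp add: gaussian_density_def)
  next
    case False then show ?thesis
      unfolding gaussian_density_def
      by (intro continuous_intros) (auto intro!: continuous_intros matrix_vector_mult_linear_continuous_on
       continuous_on_compose2[OF matrix_vector_mult_linear_continuous_on[of UNIV]])
  qed
  then show ?thesis by (intro borel_measurable_continuous_onI)
qed

lemma sets_gaussian [simp, measurable_cong]: "sets (gaussian m S) = sets borel"
  by (simp add: gaussian_def)

lemma space_gaussian [simp]: "space (gaussian m S) = UNIV"
  by (simp add: gaussian_def)

lemma absolutely_continuous_gaussian: "absolutely_continuous lborel (gaussian m S)"
  unfolding gaussian_def by (intro absolutely_continuousI_density) simp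

text \<open>Substituting \<open>x = m + V *v a\<close> standardises the law: the Jacobian
  \<open>\<bar>det V\<bar>\<close> cancels against the same factor in the density.\<close>

lemma nn_integral_gaussian:
  fixes V W :: "real^'n^'n"
  assumes VW: "V ** W = mat 1" and [measurable]: "h \<in> borel_measurable borel"
  shows "(\<integral>\<^sup>+x. h x \<partial>gaussian m (V ** transpose V)) =
    (\<integral>\<^sup>+a. ennreal (exp (- (a \<bullet> a) / 2) / sqrt (2 * pi) ^ CARD('n)) * h (m + V *v a) \<partial>lborel)"
proof -
  have WV: "W ** V = mat 1" using VW by (simp add: matrix_left_right_inverse)
  have det: "det V \<noteq> 0" using VW by (metis det_I det_mul mult_zero_left zero_neq_one)
  have "(\<integral>\<^sup>+x. h x \<partial>gaussian m (V ** transpose V)) =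
      (\<integral>\<^sup>+x. ennreal (gaussian_density m (V ** transpose V) x) * h x \<partial>lborel)"
    by (simp add: gaussian_def nn_integral_density)
  also have "\<dots> = ennreal \<bar>det V\<bar> *
      (\<integral>\<^sup>+a. ennreal (gaussian_density m (V ** transpose V) (m + V *v a)) * h (m + V *v a) \<partial>lborel)"
    by (rule nn_integral_lborel_affine_matrix[OF det]) simp
  also have "\<dots> = (\<integral>\<^sup>+a. ennreal \<bar>det V\<bar> * 
      (ennreal (gaussian_density m (V ** transpose V) (m + V *v a)) * h (m + V *v a)) \<partial>lborel)"
    by (simp add: nn_integral_cmult)
  also have "\<dots> = (\<integral>\<^sup>+a. ennreal (exp (- (a \<bullet> a) / 2) / sqrt (2 * pi) ^ CARD('n)) * h (m + V *v a) \<partial>lborel)"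
    using det
    by (intro nn_integral_cong)
      (simp add: gaussian_density_congruence[OF VW] matrix_vector_mul_assoc WV mult.assoc[symmetric] ennreal_mult'[symmetric])
  finally show ?thesis .
qed

lemma prob_space_gaussian:
  fixes V W :: "real^'n^'n"
  assumes VW: "V ** W = mat 1"
  shows "prob_space (gaussian m (V ** transpose V))"
proof
  let ?c = "sqrt (2 * pi) ^ CARD('n)"
  have "emeasure (gaussian m (V ** transpose V)) UNIV = (\<integral>\<^sup>+x. 1 \<partial>gaussian m (V ** transpose V))"
    by simp
  also have "\<dots> = (\<integral>\<^sup>+a. ennreal (exp (- (a \<bullet> a) / 2) / ?c) * 1 \<partial>(lborel :: (real^'n) measure))"
    by (rule nn_integral_gaussian[OF VW]) simp
  also have "\<dots> = (\<integral>\<^sup>+a. ennreal (1 / ?c) * ennreal (exp (- (a \<bullet> a) / (2 * 1\<^sup>2))) \<partial>(lborel :: (real^'n) measure))"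
    by (intro nn_integral_cong) (simp add: ennreal_mult'[symmetric])
  also have "\<dots> = ennreal (1 / ?c) * ennreal ?c"
    by (subst nn_integral_cmult, simp, subst nn_integral_exp_norm2) simp_all
  also have "\<dots> = 1"
    by (simp add: ennreal_mult'[symmetric])
  finally show "emeasure (gaussian m (V ** transpose V)) (space (gaussian m (V ** transpose V))) = 1"
    by simp
qed

lemma integrable_gaussian_id:
  fixes V W :: "real^'n^'n"
  assumes VW: "V ** W = mat 1"
  shows "integrable (gaussian m (V ** transpose V)) (\<lambda>x. x)"
proof -
  let ?c = "sqrt (2 * pi) ^ CARD('n)"
  obtain K where K: "0 < K" "\<And>x. norm (V *v x) \<le> norm x * K"
    using bounded_linear.pos_bounded[OF matrix_vector_mul_bounded_linear[of V]] by blast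
  \<comment> \<open>Linear growth is paid for with half of the Gaussian exponent; what remains is a
    Gaussian with variance 2, whose integral is known.\<close>
  have bound: "exp (- (a \<bullet> a) / 2) * norm (m + V *v a) \<le> (norm m + K) * exp (- (a \<bullet> a) / (2 * (sqrt 2)\<^sup>2))"
    for a :: "real^'n"
  proof -
    let ?e = "exp (a \<bullet> a / 4)"
    have "0 \<le> (norm a / 2 - 1)\<^sup>2" by simp
    then have "norm a \<le> 1 + a \<bullet> a / 4"
      by (simp add: power2_diff dot_square_norm power_divide)
    also have "\<dots> \<le> ?e" by (rule exp_ge_add_one_self)
    finally have 1: "norm a \<le> ?e" .
    have 2: "1 \<le> ?e" by simp
    have "norm (m + V *v a) \<le> norm m + norm a * K"
      using K(2)[of a] norm_triangle_ineq[of m "V *v a"] by linarith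
    also have "\<dots> \<le> norm m * ?e + ?e * K"
      using 1 2 K(1) by (intro add_mono mult_right_mono) (auto simp: mult_le_cancel_left1)
    finally have "norm (m + V *v a) \<le> (norm m + K) * ?e" by (simp add: algebra_simps)
    then have "exp (- (a \<bullet> a) / 2) * norm (m + V *v a) \<le> exp (- (a \<bullet> a) / 2) * ((norm m + K) * ?e)"
      by (rule mult_left_mono) simp
    also have "\<dots> = (norm m + K) * (exp (- (a \<bullet> a) / 2) * ?e)" by simp
    also have "exp (- (a \<bullet> a) / 2) * ?e = exp (- (a \<bullet> a) / (2 * (sqrt 2)\<^sup>2))"
      by (simp add: exp_add[symmetric])
    finally show ?thesis .
  qed
  have "(\<integral>\<^sup>+x. ennreal (norm x) \<partial>gaussian m (V ** transpose V)) =
    (\<integral>\<^sup>+a. ennreal (exp (- (a \<bullet> a) / 2) / ?c) * ennreal (norm (m + V *v a)) \<partial>lborel)"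
    by (rule nn_integral_gaussian[OF VW]) simp
  also have "\<dots> \<le> (\<integral>\<^sup>+a. ennreal ((norm m + K) / ?c) * ennreal (exp (- (a \<bullet> a) / (2 * (sqrt 2)\<^sup>2)))
      \<partial>(lborel :: (real^'n) measure))"
    using K(1) by (intro nn_integral_mono)
      (auto simp: ennreal_mult'[symmetric] intro!: ennreal_leI divide_right_mono bound[simplified])
  also have "\<dots> < \<infinity>"
    by (subst nn_integral_cmult, simp, subst nn_integral_exp_norm2)
      (simp_all add: ennreal_mult_less_top)
  finally show ?thesis
    by (intro integrableI_bounded) simp_all
qed

section \<open>The interpolation path\<close>

lemma set_integrable_powr:
  fixes a :: real
  assumes "-1 < a"
  shows "set_integrable lborel {0..1} (\<lambda>t. t powr a)"
    and "set_integrable lborel {0..1} (\<lambda>t. (1 - t) powr a)"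
proof -
  have "(\<lambda>t::real. t powr a) integrable_on {0..1}"
    using integrable_on_powr_from_0[OF assms, of 1] by simp
  then have "(\<lambda>t::real. t powr a) absolutely_integrable_on {0..1}"
    by (intro nonnegative_absolutely_integrable_1) auto
  then show *: "set_integrable lborel {0..1} (\<lambda>t. t powr a)"
    unfolding set_integrable_def by (subst (asm) integrable_completion) auto
  \<comment> \<open>The substitution of 1 - t for t maps the unit interval onto itself and carries
    the first claim to the second.\<close>
  have "indicator {0..1::real} (1 + (-1) * t) = (indicator {0..1} t :: real)" for t
    by (auto simp: indicator_def)
  then show "set_integrable lborel {0..1} (\<lambda>t. (1 - t) powr a)"
    using lborel_integrable_real_affine[OF *[unfolded set_integrable_def], of "-1" 1]
    by (simp add: set_integrable_def)
qed

definition bridge_coeff :: "real \<Rightarrow> real" where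
  "bridge_coeff t = sqrt (2 * t * (1 - t))"

text \<open>The derivative of \<open>bridge_coeff\<close> on the open interval. At 0 and 1, where
  the true derivative is infinite, division by 0 gives the value 0.\<close>

definition bridge_coeff' :: "real \<Rightarrow> real" where
  "bridge_coeff' t = (1 - 2 * t) / bridge_coeff t"

lemma bridge_coeff_pos: "0 < t \<Longrightarrow> t < 1 \<Longrightarrow> 0 < bridge_coeff t"
  by (simp add: bridge_coeff_def)

lemma has_derivative_bridge_coeff:
  assumes "0 < t" "t < 1"
  shows "(bridge_coeff has_real_derivative bridge_coeff' t) (at t)"
proof -
  have "0 < 2 * t * (1 - t)" using assms by simp
  moreover have "((\<lambda>t. 2 * t * (1 - t)) has_real_derivative (2 - 4 * t)) (at t)"
    by (rule derivative_eq_intros refl)+ (simp add: algebra_simps)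
  ultimately have "((\<lambda>t. sqrt (2 * t * (1 - t))) has_real_derivative
      inverse (sqrt (2 * t * (1 - t))) / 2 * (2 - 4 * t)) (at t)"
    by (rule DERIV_chain2[OF DERIV_real_sqrt])
  moreover have "inverse s / 2 * (2 - 4 * t) = (1 - 2 * t) / s" for s :: real
    by (cases "s = 0") (simp_all add: field_simps)
  ultimately show ?thesis
    by (simp only: bridge_coeff_def[abs_def] bridge_coeff'_def)
qed

lemma continuous_bridge_coeff [continuous_intros]:
  "continuous_on A f \<Longrightarrow> continuous_on A (\<lambda>x. bridge_coeff (f x))"
  unfolding bridge_coeff_def by (intro continuous_intros)

lemma bridge_coeff'_measurable [measurable]: "bridge_coeff' \<in> borel_measurable borel"
  unfolding bridge_coeff'_def[abs_def] bridge_coeff_def by measurable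

text \<open>On each half of the interval the distance to the nearer endpoint is at most 2t(1-t), so
  the derivative is bounded by that distance to the power -1/2. Adding both bounds avoids a case
  distinction in the integrability argument.\<close>

lemma bridge_coeff'_powr_le:
  assumes t: "0 < t" "t < 1" and p: "0 \<le> p"
  shows "\<bar>bridge_coeff' t\<bar> powr p \<le> t powr (- p / 2) + (1 - t) powr (- p / 2)"
proof -
  have *: "\<bar>bridge_coeff' t\<bar> powr p \<le> s powr (- p / 2)" if s: "0 < s" "s \<le> 2 * t * (1 - t)" for s
  proof -
    have "\<bar>bridge_coeff' t\<bar> = \<bar>1 - 2 * t\<bar> / bridge_coeff t"
      using bridge_coeff_pos[OF t] by (simp add: bridge_coeff'_def abs_divide)
    also have "\<dots> \<le> 1 / sqrt s"
      using t s bridge_coeff_pos[OF t] by (intro frac_le) (auto simp: bridge_coeff_def)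
    also have "\<dots> = s powr (- 1 / 2)"
      using s by (simp add: powr_minus_divide powr_half_sqrt[symmetric])
    finally have "\<bar>bridge_coeff' t\<bar> powr p \<le> (s powr (- 1 / 2)) powr p"
      using p by (intro powr_mono2) auto
    then show ?thesis by (simp add: powr_powr)
  qed
  show ?thesis
  proof (cases "t \<le> 1 / 2")
    case True
    then have "t * 1 \<le> t * (2 * (1 - t))" using t by (intro mult_left_mono) auto
    then have "\<bar>bridge_coeff' t\<bar> powr p \<le> t powr (- p / 2)" using t by (intro *) auto
    then show ?thesis by (rule order_trans) simp
  next
    case False
    then have "1 * (1 - t) \<le> (2 * t) * (1 - t)" using t by (intro mult_right_mono) auto
    then have "\<bar>bridge_coeff' t\<bar> powr p \<le> (1 - t) powr (- p / 2)" using t by (intro *) auto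
    then show ?thesis by (rule order_trans) simp
  qed
qed

lemma set_integrable_bridge_coeff'_powr:
  assumes "0 \<le> p" "p < 2"
  shows "set_integrable lborel {0..1} (\<lambda>t. \<bar>bridge_coeff' t\<bar> powr p)"
proof -
  have "set_integrable lborel {0..1} (\<lambda>t. t powr (- p / 2) + (1 - t) powr (- p / 2))"
    using assms by (intro set_integral_add set_integrable_powr) auto
  then show ?thesis
  proof (rule set_integrable_bound)
    show "set_borel_measurable lborel {0..1} (\<lambda>t. \<bar>bridge_coeff' t\<bar> powr p)"
      unfolding set_borel_measurable_def by measurable
    have "AE t in lborel. t \<noteq> (0::real) \<and> t \<noteq> 1" by (intro AE_conjI AE_lborel_singleton)
    then show "AE t in lborel. t \<in> {0..1} \<longrightarrow>
        norm (\<bar>bridge_coeff' t\<bar> powr p) \<le> norm (t powr (- p / 2) + (1 - t) powr (- p / 2))"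
    proof eventually_elim
      case (elim t)
      then show ?case using bridge_coeff'_powr_le[of t p] assms by auto
    qed
  qed
qed

lemma set_integrable_bridge_coeff': "set_integrable lborel {0..1} bridge_coeff'"
proof -
  have "set_integrable lborel {0..1} (\<lambda>t. \<bar>bridge_coeff' t\<bar>)"
    using set_integrable_bridge_coeff'_powr[of 1] by simp
  then show ?thesis
    by (rule set_integrable_bound) (auto simp: set_borel_measurable_def)
qed

lemma powr_add_le:
  fixes a b p :: real
  assumes "0 \<le> a" "0 \<le> b" "0 \<le> p"
  shows "(a + b) powr p \<le> 2 powr p * (a powr p + b powr p)"
proof -
  have "(a + b) powr p \<le> (2 * max a b) powr p"
    using assms by (intro powr_mono2) auto
  also have "\<dots> = 2 powr p * max a b powr p" using assms by (simp add: powr_mult)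
  also have "\<dots> \<le> 2 powr p * (a powr p + b powr p)"
    by (intro mult_left_mono) (auto simp: max_def)
  finally show ?thesis .
qed

lemma has_vector_derivative_bridge:
  fixes x y z :: "'a::real_normed_vector"
  assumes "0 < s" "s < 1"
  shows "((\<lambda>t. (1 - t) *\<^sub>R x + t *\<^sub>R y + bridge_coeff t *\<^sub>R z) has_vector_derivative
    y - x + bridge_coeff' s *\<^sub>R z) (at s)"
proof -
  have 1: "((\<lambda>t. 1 - t) has_real_derivative -1) (at s)" by (auto intro!: derivative_eq_intros)
  have "((\<lambda>t. (1 - t) *\<^sub>R x + t *\<^sub>R y + bridge_coeff t *\<^sub>R z) has_vector_derivative
    ((1 - s) *\<^sub>R 0 + (-1) *\<^sub>R x) + (s *\<^sub>R 0 + 1 *\<^sub>R y) + (bridge_coeff s *\<^sub>R 0 + bridge_coeff' s *\<^sub>R z)) (at s)"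
    by (intro has_vector_derivative_add has_vector_derivative_scaleR has_vector_derivative_const 1
        DERIV_ident has_derivative_bridge_coeff assms)
  then show ?thesis by simp
qed

lemma continuous_on_bridge:
  fixes x y z :: "'a::real_normed_vector"
  shows "continuous_on A (\<lambda>t. (1 - t) *\<^sub>R x + t *\<^sub>R y + bridge_coeff t *\<^sub>R z)"
  by (intro continuous_intros)

text \<open>The derivative may be unbounded at both ends, so the fundamental theorem is used in its
  form for open intervals: a pointwise derivative inside, integrability, and limits of the path at
  the endpoints.\<close>

lemma W1p_path_bridge:
  fixes x y z :: "'a::euclidean_space"
  assumes p: "1 \<le> p" "p < 2"
  shows "W1p_path p (\<lambda>t. (1 - t) *\<^sub>R x + t *\<^sub>R y + bridge_coeff t *\<^sub>R z)"
    (is "W1p_path p ?F")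
  unfolding W1p_path_def
proof (intro exI[of _ "\<lambda>t. y - x + bridge_coeff' t *\<^sub>R z"] conjI ballI)
  let ?g = "\<lambda>t. y - x + bridge_coeff' t *\<^sub>R z"
  show int: "set_integrable lborel {0..1} ?g"
    by (intro set_integral_add set_integrable_scaleR_left set_integrable_bridge_coeff')
      (simp add: set_integrable_def integrable_mult_indicator)
  have "set_integrable lborel {0..1} (\<lambda>t. 2 powr p * (norm (y - x) powr p + \<bar>bridge_coeff' t\<bar> powr p * norm z powr p))"
    using p by (intro set_integrable_mult_right set_integral_add set_integrable_mult_left set_integrable_bridge_coeff'_powr)
      (auto simp: set_integrable_def integrable_mult_indicator)
  then show "set_integrable lborel {0..1} (\<lambda>t. norm (?g t) powr p)"
  proof (rule set_integrable_bound)
    show "set_borel_measurable lborel {0..1} (\<lambda>t. norm (?g t) powr p)"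
      unfolding set_borel_measurable_def by measurable
    have "norm (?g t) powr p \<le> 2 powr p * (norm (y - x) powr p + \<bar>bridge_coeff' t\<bar> powr p * norm z powr p)" for t
    proof -
      have "norm (?g t) \<le> norm (y - x) + \<bar>bridge_coeff' t\<bar> * norm z"
        using norm_triangle_ineq[of "y - x" "bridge_coeff' t *\<^sub>R z"] by simp
      then have "norm (?g t) powr p \<le> (norm (y - x) + \<bar>bridge_coeff' t\<bar> * norm z) powr p"
        using p by (intro powr_mono2) auto
      also have "\<dots> \<le> 2 powr p * (norm (y - x) powr p + (\<bar>bridge_coeff' t\<bar> * norm z) powr p)"
        using p by (intro powr_add_le) auto
      finally show ?thesis by (simp add: powr_mult)
    qed
    then show "AE t in lborel. t \<in> {0..1} \<longrightarrow> norm (norm (?g t) powr p) \<le>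
        norm (2 powr p * (norm (y - x) powr p + \<bar>bridge_coeff' t\<bar> powr p * norm z powr p))"
      by (auto simp: abs_of_nonneg)
  qed
  fix t :: real assume t: "t \<in> {0..1}"
  show "?F t = ?F 0 + (LINT s:{0..t}|lborel. ?g s)"
  \<comment> \<open>The fundamental theorem is applied on a nondegenerate interval; for t = 0 the
    domain of integration is a single point.\<close>
  proof (cases "t = 0")
    case True
    have "AE s in lborel. indicator {0} s *\<^sub>R ?g s = 0"
      using AE_lborel_singleton[of "0::real"] by eventually_elim (simp add: indicator_def)
    then have "(LINT s:{0..0}|lborel. ?g s) = 0"
      unfolding set_lebesgue_integral_def by (simp add: integral_eq_zero_AE)
    then show ?thesis using True by simp
  next
    case False
    then have t: "0 < t" "t \<le> 1" using t by auto
    have lim: "(?F \<longlongrightarrow> ?F s) (at s within A)" for s A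
    proof -
      have "continuous_on UNIV ?F" by (rule continuous_on_bridge)
      then have "continuous (at s) ?F" by (simp add: continuous_on_eq_continuous_at)
      then show ?thesis unfolding continuous_within by (rule tendsto_within_subset) simp
    qed
    have "(LBINT s=ereal 0..ereal t. ?g s) = ?F t - ?F 0"
    proof (rule interval_integral_FTC_integrable)
      show "ereal 0 < ereal t" using t by simp
      show "(?F has_vector_derivative ?g s) (at s)" if "ereal 0 < ereal s" "ereal s < ereal t" for s
        using that t by (intro has_vector_derivative_bridge) auto
      show "isCont ?g s" if "ereal 0 < ereal s" "ereal s < ereal t" for s
        using that t bridge_coeff_pos[of s] unfolding bridge_coeff'_def bridge_coeff_def
        by (intro continuous_intros) auto
      show "set_integrable lborel (einterval (ereal 0) (ereal t)) ?g"
        by (rule set_integrable_subset[OF int]) (use t in auto)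
      show "((?F \<circ> real_of_ereal) \<longlongrightarrow> ?F 0) (at_right (ereal 0))"
        unfolding ereal_tendsto_simps1 by (rule lim)
      show "((?F \<circ> real_of_ereal) \<longlongrightarrow> ?F t) (at_left (ereal t))"
        unfolding ereal_tendsto_simps1 by (rule lim)
    qed
    moreover have "(LBINT s=ereal 0..ereal t. ?g s) = (LINT s:{0..t}|lborel. ?g s)"
      using t by (intro interval_integral_Icc) auto
    ultimately have "?F t - ?F 0 = (LINT s:{0..t}|lborel. ?g s)" by (rule trans[OF sym])
    then show ?thesis by (simp only: diff_eq_eq add.commute)
  qed
qed

section \<open>Reflections preserving Lebesgue measure\<close>

lemma measure_eq_lborelI:
  fixes T :: "'a::euclidean_space \<Rightarrow> 'a"
  assumes [measurable]: "T \<in> borel_measurable borel"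
    and eq: "\<And>h. h \<in> borel_measurable borel \<Longrightarrow> (\<integral>\<^sup>+x. h (T x) \<partial>lborel) = (\<integral>\<^sup>+x. h x \<partial>lborel)"
  shows "distr lborel borel T = lborel"
proof (rule measure_eqI)
  fix A assume "A \<in> sets (distr lborel borel T)"
  then have [measurable]: "A \<in> sets borel" by simp
  have "emeasure (distr lborel borel T) A = (\<integral>\<^sup>+x. indicator A x \<partial>distr lborel borel T)" by simp
  also have "\<dots> = (\<integral>\<^sup>+x. indicator A (T x) \<partial>lborel)" by (subst nn_integral_distr) auto
  also have "\<dots> = (\<integral>\<^sup>+x. indicator A x \<partial>lborel)" by (rule eq) simp
  finally show "emeasure (distr lborel borel T) A = emeasure lborel A" by simp
qed simp

text \<open>With the second component held fixed the map is a translation of the first, so Tonelli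
  reduces the claim to translation invariance.\<close>

lemma distr_lborel_shear:
  fixes h :: "'b::euclidean_space \<Rightarrow> 'a::euclidean_space"
  assumes h: "continuous_on UNIV h"
  shows "distr lborel borel (\<lambda>x. (fst x + h (snd x), snd x)) = lborel"
proof (rule measure_eq_lborelI)
  show T [measurable]: "(\<lambda>x. (fst x + h (snd x), snd x)) \<in> borel_measurable borel"
    by (intro borel_measurable_continuous_onI continuous_intros continuous_on_compose2[OF h]) auto
  fix k :: "'a \<times> 'b \<Rightarrow> ennreal" assume k: "k \<in> borel_measurable borel"
  have m: "f \<in> borel_measurable (lborel \<Otimes>\<^sub>M lborel)" if "f \<in> borel_measurable borel" for f :: "'a \<times> 'b \<Rightarrow> ennreal"
    using that by (simp add: lborel_prod)
  have [measurable]: "(\<lambda>a. k (a, b)) \<in> borel_measurable borel" for b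
    by (rule measurable_compose[OF _ k]) (intro borel_measurable_continuous_onI continuous_intros)
  have "(\<integral>\<^sup>+x. k (fst x + h (snd x), snd x) \<partial>lborel) = (\<integral>\<^sup>+b. \<integral>\<^sup>+a. k (a + h b, b) \<partial>lborel \<partial>lborel)"
    unfolding lborel_prod[symmetric]
    by (subst lborel_pair.nn_integral_snd[symmetric]) (simp_all add: m measurable_compose[OF T k])
  also have "\<dots> = (\<integral>\<^sup>+b. \<integral>\<^sup>+a. k (a, b) \<partial>lborel \<partial>lborel)"
  proof (rule nn_integral_cong)
    fix b
    show "(\<integral>\<^sup>+a. k (a + h b, b) \<partial>lborel) = (\<integral>\<^sup>+a. k (a, b) \<partial>lborel)"
      using nn_integral_lborel_translate[of "\<lambda>a. k (a, b)" "h b"] by (simp add: add.commute)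
  qed
  also have "\<dots> = (\<integral>\<^sup>+x. k x \<partial>lborel)"
    unfolding lborel_prod[symmetric] by (rule lborel_pair.nn_integral_snd) (simp add: m k)
  finally show "(\<integral>\<^sup>+x. k (fst x + h (snd x), snd x) \<partial>lborel) = (\<integral>\<^sup>+x. k x \<partial>lborel)" .
qed

lemma nn_integral_lborel_reflect:
  fixes h :: "'a::euclidean_space \<Rightarrow> ennreal"
  assumes [measurable]: "h \<in> borel_measurable borel"
  shows "(\<integral>\<^sup>+x. h (m - x) \<partial>lborel) = (\<integral>\<^sup>+x. h x \<partial>lborel)"
  by (subst (2) lborel_affine[of "-1" m])
    (simp_all add: density_1 nn_integral_distr one_ennreal_def[symmetric])

lemma distr_lborel_fibre_reflect:
  fixes h :: "'a::euclidean_space \<Rightarrow> 'b::euclidean_space"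
  assumes h: "continuous_on UNIV h"
  shows "distr lborel borel (\<lambda>x. (fst x, h (fst x) - snd x)) = lborel"
proof (rule measure_eq_lborelI)
  show T [measurable]: "(\<lambda>x. (fst x, h (fst x) - snd x)) \<in> borel_measurable borel"
    by (intro borel_measurable_continuous_onI continuous_intros continuous_on_compose2[OF h]) auto
  fix k :: "'a \<times> 'b \<Rightarrow> ennreal" assume k: "k \<in> borel_measurable borel"
  have m: "f \<in> borel_measurable (lborel \<Otimes>\<^sub>M lborel)" if "f \<in> borel_measurable borel" for f :: "'a \<times> 'b \<Rightarrow> ennreal"
    using that by (simp add: lborel_prod)
  have [measurable]: "(\<lambda>b. k (a, b)) \<in> borel_measurable borel" for a
    by (rule measurable_compose[OF _ k]) (intro borel_measurable_continuous_onI continuous_intros)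
  have "(\<integral>\<^sup>+x. k (fst x, h (fst x) - snd x) \<partial>lborel) = (\<integral>\<^sup>+a. \<integral>\<^sup>+b. k (a, h a - b) \<partial>lborel \<partial>lborel)"
    unfolding lborel_prod[symmetric]
    by (subst lborel.nn_integral_fst[symmetric]) (simp_all add: m measurable_compose[OF T k])
  also have "\<dots> = (\<integral>\<^sup>+a. \<integral>\<^sup>+b. k (a, b) \<partial>lborel \<partial>lborel)"
    by (simp add: nn_integral_lborel_reflect[of "\<lambda>b. k (a, b)" for a])
  also have "\<dots> = (\<integral>\<^sup>+x. k x \<partial>lborel)"
    unfolding lborel_prod[symmetric] by (rule lborel.nn_integral_fst) (simp add: m k)
  finally show "(\<integral>\<^sup>+x. k (fst x, h (fst x) - snd x) \<partial>lborel) = (\<integral>\<^sup>+x. k x \<partial>lborel)" .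
qed

text \<open>The level \<open>u\<close> is kept fixed while \<open>y\<close> and \<open>z\<close> are
  reflected through \<open>k u / 2\<close> and \<open>l u / 2\<close>; the new first component is
  then the one forced by the level, which presupposes \<open>a\<close> nonzero.\<close>

definition level_reflection ::
  "real \<Rightarrow> real \<Rightarrow> real \<Rightarrow> ('a \<Rightarrow> 'a) \<Rightarrow> ('a \<Rightarrow> 'a) \<Rightarrow> 'a \<times> 'a \<times> 'a \<Rightarrow> 'a \<times> 'a \<times> 'a::euclidean_space"
where
  "level_reflection a b c k l = (\<lambda>(x, y, z).
     let u = a *\<^sub>R x + b *\<^sub>R y + c *\<^sub>R z; y' = k u - y; z' = l u - z
     in ((1 / a) *\<^sub>R (u - b *\<^sub>R y' - c *\<^sub>R z'), y', z'))"

lemma continuous_level_reflection: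
  assumes k: "continuous_on UNIV k" and l: "continuous_on UNIV l"
  shows "continuous_on UNIV (level_reflection a b c k l)"
  unfolding level_reflection_def case_prod_beta Let_def
  by (intro continuous_intros continuous_on_compose2[OF k] continuous_on_compose2[OF l]) auto

text \<open>Shearing \<open>x\<close> to \<open>u/a\<close> turns the level reflection into a point reflection of each fibre \<open>u = const\<close>.\<close>

lemma distr_lborel_level_reflection:
  fixes k l :: "'a::euclidean_space \<Rightarrow> 'a"
  assumes a: "a \<noteq> 0" and k: "continuous_on UNIV k" and l: "continuous_on UNIV l"
  shows "distr lborel borel (level_reflection a b c k l) = lborel"
proof -
  \<comment> \<open>With this \<open>h\<close> the shear replaces the first component by
    \<open>u / a\<close>. Hence \<open>g\<close>, which is fed \<open>u / a\<close>, multiplies its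
    argument by \<open>a\<close> before applying \<open>k\<close> and \<open>l\<close>.\<close>
  define h where "h w = (1 / a) *\<^sub>R (b *\<^sub>R fst w + c *\<^sub>R snd w)" for w :: "'a \<times> 'a"
  define g where "g u = (k (a *\<^sub>R u), l (a *\<^sub>R u))" for u
  let ?S = "\<lambda>x. (fst x + h (snd x), snd x)" and ?S' = "\<lambda>x. (fst x + (- h (snd x)), snd x)"
    and ?N = "\<lambda>x. (fst x, g (fst x) - snd x)"
  have ch: "continuous_on UNIV h" "continuous_on UNIV (\<lambda>w. - h w)"
    unfolding h_def by (intro continuous_intros)+
  have cg: "continuous_on UNIV g"
    unfolding g_def
    by (intro continuous_intros continuous_on_compose2[OF k] continuous_on_compose2[OF l]) auto
  have meas: "?S \<in> borel_measurable borel" "?S' \<in> borel_measurable borel" "?N \<in> borel_measurable borel"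
    by (intro borel_measurable_continuous_onI continuous_intros continuous_on_compose2[OF ch(1)]
      continuous_on_compose2[OF ch(2)] continuous_on_compose2[OF cg]; simp)+
  have "level_reflection a b c k l x = ?S' (?N (?S x))" for x
    using a by (auto simp: level_reflection_def h_def g_def Let_def algebra_simps split: prod.split)
  then have "distr lborel borel (level_reflection a b c k l) = distr lborel borel (?S' \<circ> (?N \<circ> ?S))"
    by (intro distr_cong) auto
  also have "\<dots> = distr (distr (distr lborel borel ?S) borel ?N) borel ?S'"
  proof -
    have "distr (distr lborel borel ?S) borel ?N = distr lborel borel (?N \<circ> ?S)"
      by (rule distr_distr) (unfold measurable_lborel2, rule meas, rule meas)
    moreover have "distr (distr lborel borel (?N \<circ> ?S)) borel ?S' = distr lborel borel (?S' \<circ> (?N \<circ> ?S))"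
      by (rule distr_distr) (unfold measurable_lborel1 measurable_lborel2, (rule meas measurable_comp[OF meas(1) meas(3)])+)
    ultimately show ?thesis by simp
  qed
  also have "\<dots> = lborel"
    unfolding distr_lborel_shear[OF ch(1)] distr_lborel_fibre_reflect[OF cg] distr_lborel_shear[OF ch(2)] ..
  finally show ?thesis .
qed

text \<open>The change of variables by \<open>T\<close> leaves measure and density alone and flips
  the sign of \<open>g\<close>, so the integral equals its own negative.\<close>

lemma integral_density_odd:
  fixes g :: "'a::euclidean_space \<Rightarrow> 'b::euclidean_space"
  assumes T: "distr lborel borel T = lborel" "T \<in> borel_measurable borel"
    and [measurable]: "f \<in> borel_measurable borel" "g \<in> borel_measurable borel"
    and f: "\<And>x. 0 \<le> f x" "\<And>x. f (T x) = f x" and g: "\<And>x. g (T x) = - g x"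
  shows "(LINT x|density lborel (\<lambda>x. ennreal (f x)). g x) = 0"
proof -
  let ?I = "LINT x|lborel. f x *\<^sub>R g x"
  have "?I = (LINT x|distr lborel borel T. f x *\<^sub>R g x)" by (simp only: T(1))
  also have "\<dots> = (LINT x|lborel. f (T x) *\<^sub>R g (T x))"
    using T(2) by (subst integral_distr) auto
  also have "\<dots> = - ?I" by (simp add: f g)
  finally have "?I = 0" by (simp add: eq_neg_iff_add_eq_0 flip: scaleR_2)
  then show ?thesis by (simp add: integral_density f)
qed

lemma (in prob_space) distr_pair_snd:
  assumes "sigma_finite_measure N"
  shows "distr (M \<Otimes>\<^sub>M N) N snd = N"
proof (rule measure_eqI)
  interpret N: sigma_finite_measure N by fact
  fix A assume A: "A \<in> sets (distr (M \<Otimes>\<^sub>M N) N snd)"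
  then have "emeasure (distr (M \<Otimes>\<^sub>M N) N snd) A = emeasure (M \<Otimes>\<^sub>M N) (space M \<times> A)"
    by (auto simp: emeasure_distr space_pair_measure dest: sets.sets_into_space intro!: arg_cong2[where f=emeasure])
  with A show "emeasure (distr (M \<Otimes>\<^sub>M N) N snd) A = emeasure N A"
    by (simp add: N.emeasure_pair_measure_Times emeasure_space_1)
qed simp

text \<open>For the inner product with weights 1, 1/s^2, 1/s, the vector (a, b s^2, c s) represents
  the functional \<open>x\<close>, and \<open>C\<close> is its squared norm. The new triple is twice
  the orthogonal projection onto this vector minus the old triple, that is, an orthogonal
  reflection.\<close>

lemma reflection_preserves_form:
  fixes s :: real
  assumes s: "0 < s" and x: "x = a * \<alpha> + b * \<beta> + c * \<zeta>" and C: "C = a\<^sup>2 + b\<^sup>2 * s\<^sup>2 + c\<^sup>2 * s" "C \<noteq> 0"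
  shows "(2 * a * x / C - \<alpha>)\<^sup>2 + (2 * b * s\<^sup>2 * x / C - \<beta>)\<^sup>2 / s\<^sup>2 + (2 * c * s * x / C - \<zeta>)\<^sup>2 / s
    = \<alpha>\<^sup>2 + \<beta>\<^sup>2 / s\<^sup>2 + \<zeta>\<^sup>2 / s"
proof -
  define r where "r = x / C"
  have r: "r * C = x" using C by (simp add: r_def)
  have "(2 * b * s\<^sup>2 * r - \<beta>)\<^sup>2 / s\<^sup>2 = 4 * b\<^sup>2 * s\<^sup>2 * r\<^sup>2 - 4 * b * r * \<beta> + \<beta>\<^sup>2 / s\<^sup>2"
    "(2 * c * s * r - \<zeta>)\<^sup>2 / s = 4 * c\<^sup>2 * s * r\<^sup>2 - 4 * c * r * \<zeta> + \<zeta>\<^sup>2 / s"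
    using s by (simp_all add: field_simps power2_eq_square)
  then have "(2 * a * r - \<alpha>)\<^sup>2 + (2 * b * s\<^sup>2 * r - \<beta>)\<^sup>2 / s\<^sup>2 + (2 * c * s * r - \<zeta>)\<^sup>2 / s
    = 4 * r * (r * C - x) + (\<alpha>\<^sup>2 + \<beta>\<^sup>2 / s\<^sup>2 + \<zeta>\<^sup>2 / s)"
    by (simp add: C(1) x power2_eq_square algebra_simps)
  then show ?thesis by (simp add: r) (simp add: r_def)
qed

lemma pair_density_lborel:
  fixes f :: "'a::euclidean_space \<Rightarrow> real" and g :: "'b::euclidean_space \<Rightarrow> real"
  assumes "f \<in> borel_measurable borel" "g \<in> borel_measurable borel" "\<And>x. 0 \<le> f x"
    and "sigma_finite_measure (density lborel (\<lambda>x. ennreal (g x)))"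
  shows "density lborel (\<lambda>x. ennreal (f x)) \<Otimes>\<^sub>M density lborel (\<lambda>x. ennreal (g x)) =
    density lborel (\<lambda>\<omega>. ennreal (f (fst \<omega>) * g (snd \<omega>)))"
  using assms
  by (subst pair_measure_density)
    (auto simp: lborel_prod case_prod_unfold ennreal_mult' lborel.sigma_finite_measure_axioms)

section \<open>The Gaussian interpolant\<close>

text \<open>In the coordinates \<open>W\<close> the laws of X_0, X_1 and Z have independent
  components with variances 1, \<open>(s i)^2\<close> and \<open>s i\<close>. Taking
  \<open>s\<close> as the primitive parameter, with the eigenvalues as its squares, keeps roots out
  of the computations.\<close>

locale gaussian_endpoints =
  fixes m0 m1 :: "real^'n" and V W :: "real^'n^'n" and s :: "'n \<Rightarrow> real"
  assumes VW: "V ** W = mat 1" and WV: "W ** V = mat 1" and s_pos: "\<And>i. 0 < s i"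
begin

abbreviation "P0 \<equiv> gaussian m0 (V ** transpose V)"
abbreviation "P1 \<equiv> gaussian m1 (V ** diag_mat (\<lambda>i. (s i)\<^sup>2) ** transpose V)"
abbreviation "Q \<equiv> gaussian 0 (V ** diag_mat s ** transpose V)"
abbreviation "M \<equiv> P0 \<Otimes>\<^sub>M (P1 \<Otimes>\<^sub>M Q)"

section \<open>The joint law in decoupled coordinates\<close>

lemma s_nonzero [simp]: "s i \<noteq> 0"
  using s_pos[of i] by simp

lemma V_W [simp]: "V *v (W *v x) = x" and W_V [simp]: "W *v (V *v x) = x"
  using VW WV by (simp_all add: matrix_vector_mul_assoc)

lemma W_inj: "inj (\<lambda>x. W *v x)"
  by (rule inj_on_inverseI[of _ "\<lambda>x. V *v x"]) (rule V_W)

text \<open>Scaling the columns of \<open>V\<close> by square roots gives the form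
  \<open>A ** transpose A\<close>, with an explicit inverse of \<open>A\<close>, on which the
  Gaussian lemmas are stated.\<close>

lemma covariance_factor:
  assumes d: "\<And>i. 0 < d i"
  shows "V ** diag_mat d ** transpose V = (V ** diag_mat (\<lambda>i. sqrt (d i))) ** transpose (V ** diag_mat (\<lambda>i. sqrt (d i)))"
    and "(V ** diag_mat (\<lambda>i. sqrt (d i))) ** (diag_mat (\<lambda>i. 1 / sqrt (d i)) ** W) = mat 1"
proof -
  have *: "diag_mat (\<lambda>i. sqrt (d i)) ** diag_mat (\<lambda>i. sqrt (d i)) = diag_mat d"
    "diag_mat (\<lambda>i. sqrt (d i)) ** diag_mat (\<lambda>i. 1 / sqrt (d i)) = mat 1"
    using d by (simp_all add: diag_mat_mult less_imp_le less_imp_neq[OF d, symmetric] diag_mat_one)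
  have "(V ** diag_mat (\<lambda>i. sqrt (d i))) ** transpose (V ** diag_mat (\<lambda>i. sqrt (d i)))
      = V ** (diag_mat (\<lambda>i. sqrt (d i)) ** diag_mat (\<lambda>i. sqrt (d i))) ** transpose V"
    by (simp add: matrix_transpose_mul matrix_mul_assoc)
  then show "V ** diag_mat d ** transpose V = (V ** diag_mat (\<lambda>i. sqrt (d i))) ** transpose (V ** diag_mat (\<lambda>i. sqrt (d i)))"
    by (simp add: *)
  have "(V ** diag_mat (\<lambda>i. sqrt (d i))) ** (diag_mat (\<lambda>i. 1 / sqrt (d i)) ** W)
      = V ** (diag_mat (\<lambda>i. sqrt (d i)) ** diag_mat (\<lambda>i. 1 / sqrt (d i))) ** W"
    by (simp only: matrix_mul_assoc)
  then show "(V ** diag_mat (\<lambda>i. sqrt (d i))) ** (diag_mat (\<lambda>i. 1 / sqrt (d i)) ** W) = mat 1"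
    by (simp add: * VW)
qed

text \<open>The normaliser is hidden behind one positive constant independent of \<open>m\<close>
  and \<open>x\<close>: the symmetry argument only has to know that the density is a function of the
  quadratic form.\<close>

lemma gaussian_density_covariance:
  assumes d: "\<And>i. 0 < d i"
  shows "\<exists>c>0. \<forall>m x. gaussian_density m (V ** diag_mat d ** transpose V) x =
      exp (- (\<Sum>i\<in>UNIV. ((W *v (x - m)) $ i)\<^sup>2 / d i) / 2) / c"
proof (intro exI conjI allI)
  let ?A = "V ** diag_mat (\<lambda>i. sqrt (d i))"
  note f = covariance_factor[of d, OF d]
  have "det ?A \<noteq> 0" using f(2) by (metis det_I det_mul mult_zero_left zero_neq_one)
  then show "0 < sqrt (2 * pi) ^ CARD('n) * \<bar>det ?A\<bar>" by simp
  fix m x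
  have "(diag_mat (\<lambda>i. 1 / sqrt (d i)) *v y) \<bullet> (diag_mat (\<lambda>i. 1 / sqrt (d i)) *v y) = (\<Sum>i\<in>UNIV. (y $ i)\<^sup>2 / d i)" for y :: "real^'n"
    by (simp add: diag_mat_mult_vec inner_vec_def power2_eq_square[symmetric] power_divide less_imp_le[OF d])
  then show "gaussian_density m (V ** diag_mat d ** transpose V) x =
      exp (- (\<Sum>i\<in>UNIV. ((W *v (x - m)) $ i)\<^sup>2 / d i) / 2) / (sqrt (2 * pi) ^ CARD('n) * \<bar>det ?A\<bar>)"
    unfolding f(1) gaussian_density_congruence[OF f(2)] by (simp add: matrix_vector_mul_assoc[symmetric])
qed

lemma prob_space_covariance:
  "(\<And>i. 0 < d i) \<Longrightarrow> prob_space (gaussian m (V ** diag_mat d ** transpose V))"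
  using covariance_factor[of d] by (simp add: prob_space_gaussian)

lemma integrable_covariance:
  "(\<And>i. 0 < d i) \<Longrightarrow> integrable (gaussian m (V ** diag_mat d ** transpose V)) (\<lambda>x. x)"
  using covariance_factor[of d] by (simp add: integrable_gaussian_id)

sublocale P0: prob_space P0 by (rule prob_space_gaussian[OF VW])
sublocale P1: prob_space P1 by (rule prob_space_covariance) (simp add: s_pos)
sublocale Q: prob_space Q by (rule prob_space_covariance) (simp add: s_pos)
sublocale P1Q: pair_prob_space P1 Q ..
sublocale M: pair_prob_space P0 "P1 \<Otimes>\<^sub>M Q" ..

text \<open>Summed over \<open>i\<close> and multiplied by -1/2 this is the exponent of the joint
  density. It is kept coordinatewise because the reflection preserves each summand
  separately.\<close>

definition energy :: "(real^'n) \<times> (real^'n) \<times> (real^'n) \<Rightarrow> 'n \<Rightarrow> real" where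
  "energy = (\<lambda>(x, y, z) i. ((W *v (x - m0)) $ i)\<^sup>2 + ((W *v (y - m1)) $ i)\<^sup>2 / (s i)\<^sup>2 + ((W *v z) $ i)\<^sup>2 / s i)"

lemma M_density:
  obtains f where "f \<in> borel_measurable borel" "\<And>\<omega>. 0 \<le> f \<omega>" "M = density lborel (\<lambda>\<omega>. ennreal (f \<omega>))"
    "\<And>\<omega> \<omega>'. energy \<omega> = energy \<omega>' \<Longrightarrow> f \<omega> = f \<omega>'"
proof -
  \<comment> \<open>Writing the first covariance with unit diagonal lets all three densities come
    from the same lemma.\<close>
  have S0: "V ** transpose V = V ** diag_mat (\<lambda>i. 1) ** transpose V" by (simp add: diag_mat_one)
  obtain c0 where c0: "0 < c0" and d0: "\<And>x. gaussian_density m0 (V ** transpose V) x =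
      exp (- (\<Sum>i\<in>UNIV. ((W *v (x - m0)) $ i)\<^sup>2 / 1) / 2) / c0"
    using gaussian_density_covariance[of "\<lambda>_. 1"] unfolding S0 by auto
  obtain c1 where c1: "0 < c1" and d1: "\<And>x. gaussian_density m1 (V ** diag_mat (\<lambda>i. (s i)\<^sup>2) ** transpose V) x =
      exp (- (\<Sum>i\<in>UNIV. ((W *v (x - m1)) $ i)\<^sup>2 / (s i)\<^sup>2) / 2) / c1"
    using gaussian_density_covariance[of "\<lambda>i. (s i)\<^sup>2"] s_pos by auto
  obtain c2 where c2: "0 < c2" and d2: "\<And>x. gaussian_density 0 (V ** diag_mat s ** transpose V) x =
      exp (- (\<Sum>i\<in>UNIV. ((W *v (x - 0)) $ i)\<^sup>2 / s i) / 2) / c2"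
    using gaussian_density_covariance[of s] s_pos by blast
  define f0 where "f0 = gaussian_density m0 (V ** transpose V)"
  define f1 where "f1 = gaussian_density m1 (V ** diag_mat (\<lambda>i. (s i)\<^sup>2) ** transpose V)"
  define f2 where "f2 = gaussian_density 0 (V ** diag_mat s ** transpose V)"
  note d = d0[folded f0_def] d1[folded f1_def] d2[folded f2_def]
  have [measurable]: "f0 \<in> borel_measurable borel" "f1 \<in> borel_measurable borel" "f2 \<in> borel_measurable borel"
    by (simp_all add: f0_def f1_def f2_def)
  have nn: "0 \<le> f0 x" "0 \<le> f1 x" "0 \<le> f2 x" for x using c0 c1 c2 by (simp_all add: d)
  define f where "f \<omega> = f0 (fst \<omega>) * (f1 (fst (snd \<omega>)) * f2 (snd (snd \<omega>)))" for \<omega>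
  have M2: "P1 \<Otimes>\<^sub>M Q = density lborel (\<lambda>\<omega>. ennreal (f1 (fst \<omega>) * f2 (snd \<omega>)))"
    unfolding gaussian_def f1_def[symmetric] f2_def[symmetric]
    by (rule pair_density_lborel) (use Q.sigma_finite_measure_axioms nn in \<open>auto simp: gaussian_def f2_def[symmetric]\<close>)
  have m2: "(\<lambda>\<omega>. f1 (fst \<omega>) * f2 (snd \<omega>)) \<in> borel_measurable borel"
    unfolding borel_prod[symmetric] by measurable
  have "M = density lborel (\<lambda>x. ennreal (f0 x)) \<Otimes>\<^sub>M density lborel (\<lambda>\<omega>. ennreal (f1 (fst \<omega>) * f2 (snd \<omega>)))"
    unfolding M2 by (simp add: gaussian_def f0_def)
  also have "\<dots> = density lborel (\<lambda>\<omega>. ennreal (f \<omega>))"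
    unfolding f_def
    by (rule pair_density_lborel) (use m2 M2 P1Q.sigma_finite_measure_axioms nn in auto)
  finally have fM: "M = density lborel (\<lambda>\<omega>. ennreal (f \<omega>))" .
  have fm: "f \<in> borel_measurable borel"
    unfolding f_def borel_prod[symmetric] by measurable
  have f_nn: "0 \<le> f \<omega>" for \<omega> by (simp add: f_def nn)
  have "f \<omega> = exp (- (\<Sum>i\<in>UNIV. energy \<omega> i) / 2) / (c0 * (c1 * c2))" for \<omega>
    by (cases \<omega>) (simp add: f_def d energy_def sum.distrib exp_add[symmetric] add_divide_distrib diff_divide_distrib)
  then have "f \<omega> = f \<omega>'" if "energy \<omega> = energy \<omega>'" for \<omega> \<omega>' by (simp only: that)
  then show ?thesis by (rule that[OF fm f_nn fM])
qed

lemma sets_M [measurable_cong]: "sets M = sets borel"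
proof (rule M_density)
  fix f :: "(real^'n) \<times> (real^'n) \<times> (real^'n) \<Rightarrow> real"
  assume M: "M = density lborel (\<lambda>\<omega>. ennreal (f \<omega>))"
  show ?thesis unfolding M by simp
qed

section \<open>The velocity field and the reflection along the regression on X_t\<close>

definition mean :: "real \<Rightarrow> real^'n" where
  "mean t = (1 - t) *\<^sub>R m0 + t *\<^sub>R m1"

definition sd :: "real \<Rightarrow> 'n \<Rightarrow> real" where
  "sd t i = (1 - t) + t * s i"

definition vel :: "real \<Rightarrow> real^'n \<Rightarrow> real^'n" where
  "vel t x = m1 - m0 + V *v (diag_mat (\<lambda>i. (s i - 1) / sd t i) *v (W *v (x - mean t)))"

definition X :: "real \<Rightarrow> (real^'n) \<times> (real^'n) \<times> (real^'n) \<Rightarrow> real^'n" where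
  "X t \<omega> = (1 - t) *\<^sub>R fst \<omega> + t *\<^sub>R fst (snd \<omega>) + bridge_coeff t *\<^sub>R snd (snd \<omega>)"

definition dX :: "real \<Rightarrow> (real^'n) \<times> (real^'n) \<times> (real^'n) \<Rightarrow> real^'n" where
  "dX t \<omega> = fst (snd \<omega>) - fst \<omega> + bridge_coeff' t *\<^sub>R snd (snd \<omega>)"

lemma sd_pos: "t \<in> {0..1} \<Longrightarrow> 0 < sd t i"
  using s_pos[of i] unfolding sd_def by (cases "t = 1") (auto intro!: add_pos_nonneg)

text \<open>A convex combination of 1 and \<open>s i\<close> is bounded below independently of t;
  this is what makes the Lipschitz constant of \<open>vel\<close> uniform in time.\<close>

lemma sd_ge: "t \<in> {0..1} \<Longrightarrow> min 1 (s i) \<le> sd t i"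
proof -
  assume t: "t \<in> {0..1}"
  have "(1 - t) * min 1 (s i) + t * min 1 (s i) \<le> (1 - t) * 1 + t * s i"
    using t by (intro add_mono mult_left_mono) auto
  then show ?thesis by (simp add: sd_def algebra_simps)
qed

lemma continuous_on_matrix_vector_mult:
  "continuous_on A f \<Longrightarrow> continuous_on A (\<lambda>x. (B :: real^'n^'n) *v f x)"
  by (rule bounded_linear.continuous_on[OF matrix_vector_mul_bounded_linear])

lemma continuous_vel: "continuous_on UNIV (vel t)"
  unfolding vel_def by (intro continuous_intros continuous_on_matrix_vector_mult)

lemma continuous_X: "continuous_on UNIV (X t)"
  unfolding X_def by (intro continuous_intros)

lemma continuous_dX: "continuous_on UNIV (dX t)"
  unfolding dX_def by (intro continuous_intros)

text \<open>The diagonal entries are twice the regression coefficients of X_1 and Z on X_t, namely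
  covariance over variance in each coordinate. The offset is twice the mean of X_1, while Z is
  centred.\<close>

definition reflect :: "real \<Rightarrow> (real^'n) \<times> (real^'n) \<times> (real^'n) \<Rightarrow> (real^'n) \<times> (real^'n) \<times> (real^'n)" where
  "reflect t = level_reflection (1 - t) t (bridge_coeff t)
    (\<lambda>u. 2 *\<^sub>R m1 + V *v (diag_mat (\<lambda>i. 2 * t * (s i)\<^sup>2 / (sd t i)\<^sup>2) *v (W *v (u - mean t))))
    (\<lambda>u. V *v (diag_mat (\<lambda>i. 2 * bridge_coeff t * s i / (sd t i)\<^sup>2) *v (W *v (u - mean t))))"

lemma reflect_lborel:
  assumes "t < 1"
  shows "reflect t \<in> borel_measurable borel" "distr lborel borel (reflect t) = lborel"
proof -
  note c = continuous_intros continuous_on_matrix_vector_mult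
  show "reflect t \<in> borel_measurable borel"
    unfolding reflect_def by (intro borel_measurable_continuous_onI continuous_level_reflection c)
  show "distr lborel borel (reflect t) = lborel"
    unfolding reflect_def using assms by (intro distr_lborel_level_reflection c) auto
qed

text \<open>The formulas for \<open>y'\<close> and \<open>z'\<close> are built into
  \<open>reflect\<close>. The one for \<open>x'\<close> has to be derived, since \<open>x'\<close>
  is obtained by solving for the level; it takes the same regression form because the three variance
  contributions add up to \<open>(sd t i)^2\<close>.\<close>

lemma reflect_coords:
  fixes x y z :: "real^'n"
  assumes t: "0 < t" "t < 1"
  defines "\<xi> \<equiv> \<lambda>i. (W *v (X t (x, y, z) - mean t)) $ i"
  obtains x' y' z' where "reflect t (x, y, z) = (x', y', z')" "X t (x', y', z') = X t (x, y, z)"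
    "\<And>i. (W *v (x' - m0)) $ i = 2 * (1 - t) * \<xi> i / (sd t i)\<^sup>2 - (W *v (x - m0)) $ i"
    "\<And>i. (W *v (y' - m1)) $ i = 2 * t * (s i)\<^sup>2 * \<xi> i / (sd t i)\<^sup>2 - (W *v (y - m1)) $ i"
    "\<And>i. (W *v z') $ i = 2 * bridge_coeff t * s i * \<xi> i / (sd t i)\<^sup>2 - (W *v z) $ i"
proof -
  define u where "u = X t (x, y, z)"
  define y' where "y' = 2 *\<^sub>R m1 + V *v (diag_mat (\<lambda>i. 2 * t * (s i)\<^sup>2 / (sd t i)\<^sup>2) *v (W *v (u - mean t))) - y"
  define z' where "z' = V *v (diag_mat (\<lambda>i. 2 * bridge_coeff t * s i / (sd t i)\<^sup>2) *v (W *v (u - mean t))) - z"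
  define x' where "x' = (1 / (1 - t)) *\<^sub>R (u - t *\<^sub>R y' - bridge_coeff t *\<^sub>R z')"
  have eq: "reflect t (x, y, z) = (x', y', z')"
    by (simp add: reflect_def level_reflection_def Let_def x'_def y'_def z'_def u_def X_def)
  have X': "X t (x', y', z') = u"
    using t by (simp add: X_def x'_def)
  have xi: "(W *v (u - mean t)) $ i = \<xi> i" for i by (simp add: \<xi>_def u_def)
  have wx: "(W *v (X t (a, b, c) - mean t)) $ i =
      (1 - t) * (W *v (a - m0)) $ i + t * (W *v (b - m1)) $ i + bridge_coeff t * (W *v c) $ i" for a b c i
  proof -
    have "X t (a, b, c) - mean t = (1 - t) *\<^sub>R (a - m0) + t *\<^sub>R (b - m1) + bridge_coeff t *\<^sub>R c"
      by (simp add: X_def mean_def algebra_simps)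
    then show ?thesis by (simp add: matrix_vector_right_distrib matrix_vector_mult_scaleR)
  qed
  have Y: "(W *v (y' - m1)) $ i = 2 * t * (s i)\<^sup>2 * \<xi> i / (sd t i)\<^sup>2 - (W *v (y - m1)) $ i" for i
  proof -
    have "y' - m1 = V *v (diag_mat (\<lambda>i. 2 * t * (s i)\<^sup>2 / (sd t i)\<^sup>2) *v (W *v (u - mean t))) - (y - m1)"
      by (simp add: y'_def scaleR_2)
    then have "W *v (y' - m1) = W *v (V *v (diag_mat (\<lambda>i. 2 * t * (s i)\<^sup>2 / (sd t i)\<^sup>2) *v (W *v (u - mean t)))) - W *v (y - m1)"
      by (simp only: matrix_vector_mult_diff_distrib)
    then show ?thesis
      by (simp only: W_V diag_mat_mult_vec vector_minus_component vec_lambda_beta xi times_divide_eq_left)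
  qed
  have Z: "(W *v z') $ i = 2 * bridge_coeff t * s i * \<xi> i / (sd t i)\<^sup>2 - (W *v z) $ i" for i
    unfolding z'_def matrix_vector_mult_diff_distrib[of W _ z]
    by (simp only: W_V diag_mat_mult_vec vector_minus_component vec_lambda_beta xi times_divide_eq_left)
  have bc: "(bridge_coeff t)\<^sup>2 = 2 * t * (1 - t)" using t by (simp add: bridge_coeff_def)
  have "(W *v (x' - m0)) $ i = 2 * (1 - t) * \<xi> i / (sd t i)\<^sup>2 - (W *v (x - m0)) $ i" for i
  proof -
    define C where "C = (sd t i)\<^sup>2"
    have C: "C = (1 - t)\<^sup>2 + t\<^sup>2 * (s i)\<^sup>2 + (bridge_coeff t)\<^sup>2 * s i"
      unfolding bc C_def sd_def by (simp add: power2_eq_square algebra_simps)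
    have "C \<noteq> 0" using sd_pos[of t i] t by (simp add: C_def)
    define r where "r = \<xi> i / C"
    have r: "r * C = \<xi> i" using \<open>C \<noteq> 0\<close> by (simp add: r_def)
    have "(1 - t) * (W *v (x' - m0)) $ i = \<xi> i - t * (W *v (y' - m1)) $ i - bridge_coeff t * (W *v z') $ i"
      using wx[of x' y' z' i] by (simp add: X' xi)
    also have "\<dots> = \<xi> i - t * (2 * t * (s i)\<^sup>2 * r - (W *v (y - m1)) $ i)
        - bridge_coeff t * (2 * bridge_coeff t * s i * r - (W *v z) $ i)"
      by (simp add: Y Z r_def C_def)
    \<comment> \<open>The contributions of X_1 and Z to the variance are replaced by
      \<open>C\<close> minus that of X_0, after which only the vanishing term
      \<open>\<xi> i - r * C\<close> separates the two sides.\<close>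
    also have "\<dots> = \<xi> i - 2 * r * (C - (1 - t)\<^sup>2) + t * (W *v (y - m1)) $ i + bridge_coeff t * (W *v z) $ i"
      unfolding C by (simp add: power2_eq_square algebra_simps)
    also have "\<dots> = (1 - t) * (2 * (1 - t) * r - (W *v (x - m0)) $ i) + 2 * (\<xi> i - r * C)"
      using wx[of x y z i] xi[of i] by (simp add: u_def power2_eq_square algebra_simps)
    finally have "(W *v (x' - m0)) $ i = 2 * (1 - t) * r - (W *v (x - m0)) $ i"
      using t by (simp add: r)
    then show ?thesis by (simp add: r_def C_def)
  qed
  then show ?thesis using that[OF eq] X' Y Z by (simp add: u_def)
qed

text \<open>Energy is preserved because in each coordinate the map is the orthogonal reflection with
  coefficients \<open>1 - t\<close>, \<open>t\<close>, \<open>bridge_coeff t\<close>. For the sign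
  change, the residuals at a point and at its image sum to twice the residual of the regression
  part, which is 0.\<close>

lemma reflect_form:
  assumes t: "0 < t" "t < 1"
  shows "energy (reflect t \<omega>) = energy \<omega>" "X t (reflect t \<omega>) = X t \<omega>"
    "dX t (reflect t \<omega>) - vel t (X t (reflect t \<omega>)) = - (dX t \<omega> - vel t (X t \<omega>))"
proof -
  obtain x y z where \<omega>: "\<omega> = (x, y, z)" by (cases \<omega>)
  define \<xi> where "\<xi> i = (W *v (X t (x, y, z) - mean t)) $ i" for i
  obtain x' y' z' where R: "reflect t (x, y, z) = (x', y', z')" "X t (x', y', z') = X t (x, y, z)"
    and x': "\<And>i. (W *v (x' - m0)) $ i = 2 * (1 - t) * \<xi> i / (sd t i)\<^sup>2 - (W *v (x - m0)) $ i"
    and y': "\<And>i. (W *v (y' - m1)) $ i = 2 * t * (s i)\<^sup>2 * \<xi> i / (sd t i)\<^sup>2 - (W *v (y - m1)) $ i"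
    and z': "\<And>i. (W *v z') $ i = 2 * bridge_coeff t * s i * \<xi> i / (sd t i)\<^sup>2 - (W *v z) $ i"
    using reflect_coords[OF t, of x y z] unfolding \<xi>_def by metis
  show "X t (reflect t \<omega>) = X t \<omega>" by (simp add: \<omega> R)
  have bc: "(bridge_coeff t)\<^sup>2 = 2 * t * (1 - t)" using t by (simp add: bridge_coeff_def)
  have bc': "bridge_coeff' t * bridge_coeff t = 1 - 2 * t"
    using bridge_coeff_pos[OF t] by (simp add: bridge_coeff'_def)
  have xi: "\<xi> i = (1 - t) * (W *v (x - m0)) $ i + t * (W *v (y - m1)) $ i + bridge_coeff t * (W *v z) $ i" for i
  proof -
    have "X t (x, y, z) - mean t = (1 - t) *\<^sub>R (x - m0) + t *\<^sub>R (y - m1) + bridge_coeff t *\<^sub>R z"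
      by (simp add: X_def mean_def algebra_simps)
    then show ?thesis by (simp add: \<xi>_def matrix_vector_right_distrib matrix_vector_mult_scaleR)
  qed
  have sd: "(sd t i)\<^sup>2 = (1 - t)\<^sup>2 + t\<^sup>2 * (s i)\<^sup>2 + (bridge_coeff t)\<^sup>2 * s i" for i
    unfolding bc sd_def by (simp add: power2_eq_square algebra_simps)
  have sd0: "sd t i \<noteq> 0" for i using sd_pos[of t i] t by simp
  have "energy (x', y', z') = energy (x, y, z)"
    by (intro ext) (simp only: energy_def prod.case x' y' z' reflection_preserves_form[OF s_pos xi sd]
        sd0 power_eq_0_iff simp_thms)
  then show "energy (reflect t \<omega>) = energy \<omega>" by (simp add: \<omega> R)
  have res: "W *v (dX t (a, b, c) - vel t v) = (\<chi> i. (W *v (b - m1)) $ i - (W *v (a - m0)) $ i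
      + bridge_coeff' t * (W *v c) $ i - (s i - 1) / sd t i * (W *v (v - mean t)) $ i)" for a b c v
  proof -
    have "dX t (a, b, c) - vel t v = (b - m1) - (a - m0) + bridge_coeff' t *\<^sub>R c
        - V *v (diag_mat (\<lambda>i. (s i - 1) / sd t i) *v (W *v (v - mean t)))"
      by (simp add: dX_def vel_def)
    then have "W *v (dX t (a, b, c) - vel t v) = W *v (b - m1) - W *v (a - m0) + bridge_coeff' t *\<^sub>R (W *v c)
        - diag_mat (\<lambda>i. (s i - 1) / sd t i) *v (W *v (v - mean t))"
      by (simp add: matrix_vector_right_distrib matrix_vector_mult_diff_distrib matrix_vector_mult_scaleR
        del: diff_diff_eq)
    then show ?thesis by (simp add: vec_eq_iff diag_mat_mult_vec)
  qed
  have "(W *v (dX t (x', y', z') - vel t (X t (x', y', z')))) $ i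
      = - (W *v (dX t (x, y, z) - vel t (X t (x, y, z)))) $ i" for i
  proof -
    define r where "r = \<xi> i / (sd t i)\<^sup>2"
    have q: "a * \<xi> i / (sd t i)\<^sup>2 = a * r" for a by (simp add: r_def)
    have k: "(s i - 1) / sd t i * \<xi> i = (s i - 1) * sd t i * r"
      using sd0[of i] by (simp add: r_def power2_eq_square)
    have "(W *v (dX t (x', y', z') - vel t (X t (x', y', z')))) $ i
      + (W *v (dX t (x, y, z) - vel t (X t (x, y, z)))) $ i
      = 2 * r * (t * (s i)\<^sup>2 - (1 - t) + bridge_coeff' t * bridge_coeff t * s i) - 2 * ((s i - 1) / sd t i * \<xi> i)"
      unfolding res R(2) vec_lambda_beta x' y' z' \<xi>_def[symmetric] q by (simp add: algebra_simps)
    \<comment> \<open>This is the identity t s^2 - (1-t) + (1-2t) s = (s-1)((1-t) + ts): the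
      covariance of velocity and position equals the rate times the variance.\<close>
    also have "\<dots> = 0"
      unfolding k bc' unfolding sd_def by (simp add: power2_eq_square algebra_simps)
    finally show ?thesis by simp
  qed
  then have "W *v (dX t (x', y', z') - vel t (X t (x', y', z'))) = W *v (- (dX t (x, y, z) - vel t (X t (x, y, z))))"
    by (simp only: vec_eq_iff linear_neg[OF matrix_vector_mul_linear] vector_uminus_component simp_thms)
  then have "dX t (x', y', z') - vel t (X t (x', y', z')) = - (dX t (x, y, z) - vel t (X t (x, y, z)))"
    by (rule injD[OF W_inj])
  then show "dX t (reflect t \<omega>) - vel t (X t (reflect t \<omega>)) = - (dX t \<omega> - vel t (X t \<omega>))" by (simp add: \<omega> R(1))
qed

lemma conditional_residual_zero:
  assumes t: "0 < t" "t < 1" and A [measurable]: "A \<in> sets borel"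
  shows "(LINT \<omega>|M. indicator A (X t \<omega>) *\<^sub>R (dX t \<omega> - vel t (X t \<omega>))) = 0"
proof -
  obtain f where f: "f \<in> borel_measurable borel" "\<And>\<omega>. 0 \<le> f \<omega>" "M = density lborel (\<lambda>\<omega>. ennreal (f \<omega>))"
    and inv: "\<And>\<omega> \<omega>'. energy \<omega> = energy \<omega>' \<Longrightarrow> f \<omega> = f \<omega>'"
    using M_density by blast
  have [measurable]: "X t \<in> borel_measurable borel" "dX t \<in> borel_measurable borel" "vel t \<in> borel_measurable borel"
    by (intro borel_measurable_continuous_onI continuous_X continuous_dX continuous_vel)+
  note R = reflect_form[OF t]
  show ?thesis
    unfolding f(3)
  proof (rule integral_density_odd[where T = "reflect t"])
    show "distr lborel borel (reflect t) = lborel" "reflect t \<in> borel_measurable borel"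
      using reflect_lborel[of t] t by auto
    show "(\<lambda>\<omega>. indicator A (X t \<omega>) *\<^sub>R (dX t \<omega> - vel t (X t \<omega>))) \<in> borel_measurable borel"
      by measurable
    show "indicator A (X t (reflect t \<omega>)) *\<^sub>R (dX t (reflect t \<omega>) - vel t (X t (reflect t \<omega>))) =
      - (indicator A (X t \<omega>) *\<^sub>R (dX t \<omega> - vel t (X t \<omega>)))" for \<omega>
      unfolding R(3) unfolding R(2) by (rule scaleR_minus_right)
    show "f (reflect t \<omega>) = f \<omega>" for \<omega> by (rule inv[OF R(1)])
  qed (rule f)+
qed

section \<open>Integrability and the conditional velocity\<close>

lemma continuous_imp_measurable_M:
  "continuous_on UNIV f \<Longrightarrow> f \<in> borel_measurable M"
  by (simp add: measurable_cong_sets[OF sets_M refl] borel_measurable_continuous_onI)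

lemma integrable_M_coords:
  "integrable M (\<lambda>\<omega>. fst \<omega>)" "integrable M (\<lambda>\<omega>. fst (snd \<omega>))" "integrable M (\<lambda>\<omega>. snd (snd \<omega>))"
proof -
  have P: "integrable P0 (\<lambda>x. x)" "integrable P1 (\<lambda>x. x)" "integrable Q (\<lambda>x. x)"
    by (rule integrable_gaussian_id[OF VW], (rule integrable_covariance, simp add: s_pos)+)
  have PQ: "integrable (P1 \<Otimes>\<^sub>M Q) (\<lambda>\<omega>. fst \<omega>)" "integrable (P1 \<Otimes>\<^sub>M Q) (\<lambda>\<omega>. snd \<omega>)"
    using P(2,3) Q.distr_pair_fst[of P1] P1.distr_pair_snd[OF Q.sigma_finite_measure_axioms]
      integrable_distr[of fst "P1 \<Otimes>\<^sub>M Q" P1 "\<lambda>x. x"] integrable_distr[of snd "P1 \<Otimes>\<^sub>M Q" Q "\<lambda>x. x"]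
    by simp_all
  show "integrable M (\<lambda>\<omega>. fst \<omega>)"
    using P(1) P1Q.distr_pair_fst[of P0] integrable_distr[of fst M P0 "\<lambda>x. x"] by simp
  have "distr M (P1 \<Otimes>\<^sub>M Q) snd = P1 \<Otimes>\<^sub>M Q"
    by (rule P0.distr_pair_snd[OF P1Q.sigma_finite_measure_axioms])
  then show "integrable M (\<lambda>\<omega>. fst (snd \<omega>))" "integrable M (\<lambda>\<omega>. snd (snd \<omega>))"
    using PQ integrable_distr[of snd M "P1 \<Otimes>\<^sub>M Q" fst] integrable_distr[of snd M "P1 \<Otimes>\<^sub>M Q" snd]
    by simp_all
qed

lemma integrable_X: "integrable M (X t)"
  unfolding X_def[abs_def] by (intro Bochner_Integration.integrable_add integrable_scaleR_right integrable_M_coords)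

lemma integrable_dX: "integrable M (dX t)"
  unfolding dX_def[abs_def]
  by (intro Bochner_Integration.integrable_add Bochner_Integration.integrable_diff integrable_scaleR_right integrable_M_coords)

lemma integrable_vel_X: "integrable M (\<lambda>\<omega>. vel t (X t \<omega>))"
  unfolding vel_def
  by (intro Bochner_Integration.integrable_add integrable_bounded_linear[OF matrix_vector_mul_bounded_linear]
      Bochner_Integration.integrable_diff integrable_X M.integrable_const)

lemma X_has_vector_derivative:
  assumes "0 < t" "t < 1"
  shows "((\<lambda>s. X s \<omega>) has_vector_derivative dX t \<omega>) (at t within {0..1})"
  unfolding X_def dX_def
  by (rule has_vector_derivative_at_within[OF has_vector_derivative_bridge[OF assms]])

lemma path_velocity_X:
  assumes "0 < t" "t < 1"
  shows "path_velocity X t = dX t"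
proof
  fix \<omega>
  show "path_velocity X t \<omega> = dX t \<omega>"
    unfolding path_velocity_def
    using vector_derivative_within_cbox[of 0 1 t "\<lambda>s. X s \<omega>" "dX t \<omega>"] X_has_vector_derivative[OF assms, of \<omega>] assms
    by simp
qed

lemma cond_velocity_X: "cond_velocity M X vel"
  unfolding cond_velocity_def
proof
  have "continuous_on ({0..1} \<times> UNIV) (\<lambda>p. vel (fst p) (snd p))"
  proof -
    have "continuous_on ({0..1} \<times> UNIV) (\<lambda>p. (s i - 1) / sd (fst p) i * (W *v (snd p - mean (fst p))) $ i)" for i
    proof -
      have "sd (fst p) i \<noteq> 0" if "p \<in> {0..1} \<times> UNIV" for p :: "real \<times> (real^'n)"
        using that sd_pos[of "fst p" i] by (auto simp: mem_Times_iff)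
      moreover have "continuous_on ({0..1} \<times> UNIV) (\<lambda>p. sd (fst p) i)"
        unfolding sd_def by (intro continuous_intros)
      ultimately show ?thesis
        unfolding mean_def by (intro continuous_intros continuous_on_matrix_vector_mult) auto
    qed
    then show ?thesis
      unfolding vel_def diag_mat_mult_vec
      by (intro continuous_on_add continuous_on_const continuous_on_matrix_vector_mult continuous_on_vec_lambda)
  qed
  then show "(\<lambda>(t, x). vel t x) \<in> borel_measurable (restrict_space borel ({0..1} \<times> UNIV))"
    unfolding case_prod_unfold by (rule borel_measurable_continuous_on_restrict)
  \<comment> \<open>The two endpoints, where the bridge term can destroy differentiability, form a
    null set of times.\<close>
  have "AE t in lborel. t \<noteq> (0::real) \<and> t \<noteq> 1" by (intro AE_conjI AE_lborel_singleton)
  then show "AE t in lborel. t \<in> {0..1} \<longrightarrow>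
        (AE \<omega> in M. (\<lambda>s. X s \<omega>) differentiable (at t within {0..1})) \<and>
        integrable M (path_velocity X t) \<and>
        integrable M (\<lambda>\<omega>. vel t (X t \<omega>)) \<and>
        (\<forall>A\<in>sets borel.
           (LINT \<omega>:{\<omega>\<in>space M. X t \<omega> \<in> A}|M. path_velocity X t \<omega>) =
           (LINT \<omega>:{\<omega>\<in>space M. X t \<omega> \<in> A}|M. vel t (X t \<omega>)))"
  proof (eventually_elim, intro impI conjI ballI)
    fix t :: real assume "t \<noteq> 0 \<and> t \<noteq> 1" "t \<in> {0..1}"
    then have t: "0 < t" "t < 1" by auto
    show "AE \<omega> in M. (\<lambda>s. X s \<omega>) differentiable (at t within {0..1})"
      using X_has_vector_derivative[OF t] by (intro AE_I2) (rule differentiableI_vector)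
    show int: "integrable M (path_velocity X t)" "integrable M (\<lambda>\<omega>. vel t (X t \<omega>))"
      unfolding path_velocity_X[OF t] by (rule integrable_dX integrable_vel_X)+
    fix A :: "(real^'n) set" assume A: "A \<in> sets borel"
    have [measurable]: "X t \<in> borel_measurable M"
      by (intro continuous_imp_measurable_M continuous_X)
    have S: "{\<omega>\<in>space M. X t \<omega> \<in> A} \<in> sets M" using A by measurable
    have ind: "set_lebesgue_integral M {\<omega>\<in>space M. X t \<omega> \<in> A} g = (LINT \<omega>|M. indicator A (X t \<omega>) *\<^sub>R g \<omega>)"
      for g :: "_ \<Rightarrow> real^'n"
      unfolding set_lebesgue_integral_def by (intro Bochner_Integration.integral_cong) (auto simp: indicator_def)
    have i: "integrable M (\<lambda>\<omega>. indicator A (X t \<omega>) *\<^sub>R g \<omega>)" if "integrable M g" for g :: "_ \<Rightarrow> real^'n"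
      using integrable_mult_indicator[OF S that]
      by (rule Bochner_Integration.integrable_cong[THEN iffD1, rotated 2]) (auto simp: indicator_def)
    have "(LINT \<omega>|M. indicator A (X t \<omega>) *\<^sub>R dX t \<omega>) - (LINT \<omega>|M. indicator A (X t \<omega>) *\<^sub>R vel t (X t \<omega>)) = 0"
      using conditional_residual_zero[OF t A]
      by (subst Bochner_Integration.integral_diff[symmetric])
        (auto intro!: i integrable_dX integrable_vel_X simp: scaleR_diff_right)
    then show "(LINT \<omega>:{\<omega>\<in>space M. X t \<omega> \<in> A}|M. path_velocity X t \<omega>) =
           (LINT \<omega>:{\<omega>\<in>space M. X t \<omega> \<in> A}|M. vel t (X t \<omega>))"
      unfolding ind path_velocity_X[OF t] by simp
  qed
qed

lemma vel_lipschitz: "\<exists>L. \<forall>t\<in>{0..1}. lipschitz_on L UNIV (vel t)"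
proof -
  obtain KV where KV: "0 < KV" "\<And>x. norm (V *v x) \<le> norm x * KV"
    using bounded_linear.pos_bounded[OF matrix_vector_mul_bounded_linear[of V]] by blast
  obtain KW where KW: "0 < KW" "\<And>x. norm (W *v x) \<le> norm x * KW"
    using bounded_linear.pos_bounded[OF matrix_vector_mul_bounded_linear[of W]] by blast
  \<comment> \<open>A sum over coordinates serves as a common bound for all rates at all times;
    together with the operator bounds of \<open>V\<close> and \<open>W\<close> it gives the
    Lipschitz constant.\<close>
  define K where "K = (\<Sum>i\<in>UNIV. \<bar>s i - 1\<bar> / min 1 (s i))"
  have K0: "0 \<le> K"
    unfolding K_def by (intro sum_nonneg divide_nonneg_nonneg) (auto simp: less_imp_le[OF s_pos])
  have K: "\<bar>(s i - 1) / sd t i\<bar> \<le> K" if t: "t \<in> {0..1}" for t i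
  proof -
    have "\<bar>(s i - 1) / sd t i\<bar> = \<bar>s i - 1\<bar> / sd t i" using sd_pos[OF t, of i] by simp
    also have "\<dots> \<le> \<bar>s i - 1\<bar> / min 1 (s i)"
      using sd_ge[OF t, of i] s_pos[of i] by (intro divide_left_mono) (auto intro!: mult_pos_pos sd_pos t)
    also have "\<dots> \<le> K"
      unfolding K_def by (rule member_le_sum) (auto simp: less_imp_le[OF s_pos])
    finally show ?thesis .
  qed
  have "lipschitz_on (KW * K * KV) UNIV (vel t)" if t: "t \<in> {0..1}" for t
  proof (rule lipschitz_onI)
    show "0 \<le> KW * K * KV" using KV KW K0 by simp
    fix x y
    define w where "w = W *v (x - y)"
    have "vel t x - vel t y = V *v (diag_mat (\<lambda>i. (s i - 1) / sd t i) *v (W *v ((x - mean t) - (y - mean t))))"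
      unfolding vel_def by (simp only: matrix_vector_mult_diff_distrib add_diff_cancel_left)
    then have "norm (vel t x - vel t y) \<le> norm (diag_mat (\<lambda>i. (s i - 1) / sd t i) *v w) * KV"
      by (simp add: w_def KV)
    also have "norm (diag_mat (\<lambda>i. (s i - 1) / sd t i) *v w) \<le> norm (K *\<^sub>R w)"
      unfolding diag_mat_mult_vec
    proof (rule norm_le_componentwise_cart)
      fix i
      have "norm ((s i - 1) / sd t i * w $ i) \<le> K * \<bar>w $ i\<bar>"
        unfolding real_norm_def abs_mult by (intro mult_right_mono K t) simp
      then show "norm ((\<chi> i. (s i - 1) / sd t i * w $ i) $ i) \<le> norm ((K *\<^sub>R w) $ i)"
        using K0 by (simp add: abs_mult)
    qed
    also have "norm (K *\<^sub>R w) \<le> K * (norm (x - y) * KW)"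
      using K0 by (simp add: w_def mult_left_mono KW)
    finally show "dist (vel t x) (vel t y) \<le> KW * K * KV * dist x y"
      using KV(1) by (simp add: dist_norm mult_right_mono ac_simps)
  qed
  then show ?thesis by blast
qed

text \<open>This is the initial velocity \<open>vel 0 x\<close>, since \<open>sd 0 i\<close> is 1;
  it turns out to be the velocity along the whole trajectory from \<open>x\<close>.\<close>

definition slope :: "real^'n \<Rightarrow> real^'n" where
  "slope x = m1 - m0 + V *v (diag_mat (\<lambda>i. s i - 1) *v (W *v (x - m0)))"

text \<open>If the centred coordinates have grown by exactly the factor \<open>sd t i\<close>, this
  factor cancels the denominator in \<open>vel\<close>. Both the explicit flow and an arbitrary flow
  are treated by verifying this growth.\<close>

lemma vel_eq_slope:
  assumes t: "t \<in> {0..1}" and y: "\<And>i. (W *v (y - mean t)) $ i = sd t i * (W *v (x - m0)) $ i"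
  shows "vel t y = slope x"
proof -
  have "sd t i \<noteq> 0" for i using sd_pos[OF t, of i] by simp
  then show ?thesis by (simp add: vel_def slope_def diag_mat_mult_vec y)
qed

lemma is_flow_affine: "is_flow vel (\<lambda>t x. x + t *\<^sub>R slope x)"
  unfolding is_flow_def
proof (intro allI conjI ballI)
  fix x show "x + 0 *\<^sub>R slope x = x" by simp
  fix t :: real assume t: "t \<in> {0..1}"
  have "(W *v (x + t *\<^sub>R slope x - mean t)) $ i = sd t i * (W *v (x - m0)) $ i" for i
  proof -
    have "x + t *\<^sub>R slope x - mean t = (x - m0) + t *\<^sub>R (V *v (diag_mat (\<lambda>i. s i - 1) *v (W *v (x - m0))))"
      by (simp add: slope_def mean_def scaleR_add_right algebra_simps)
    then have "W *v (x + t *\<^sub>R slope x - mean t) = W *v (x - m0) + t *\<^sub>R (diag_mat (\<lambda>i. s i - 1) *v (W *v (x - m0)))"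
      by (simp only: matrix_vector_right_distrib matrix_vector_mult_scaleR W_V)
    then show ?thesis by (simp only: vector_add_component vector_scaleR_component diag_mat_mult_vec vec_lambda_beta sd_def)
      (simp add: algebra_simps)
  qed
  then have "vel t (x + t *\<^sub>R slope x) = slope x" by (intro vel_eq_slope t)
  then show "((\<lambda>t. x + t *\<^sub>R slope x) has_vector_derivative vel t (x + t *\<^sub>R slope x)) (at t within {0..1})"
    by (auto intro!: derivative_eq_intros)
qed

text \<open>In the coordinates \<open>W\<close> the flow equation decouples to \<open>w' = ((s - 1) / sd) w\<close> with
  \<open>sd' = s - 1\<close>, so that \<open>w / sd\<close> is conserved.\<close>

lemma flow_acceleration_zero:
  assumes \<phi>: "is_flow vel \<phi>" and t: "t \<in> {0..1}"
  shows "((\<lambda>t. vel t (\<phi> t x)) has_vector_derivative 0) (at t within {0..1})"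
proof -
  \<comment> \<open>\<open>w\<close> is an arbitrary given solution, centred at the moving mean and
    read in the coordinates \<open>W\<close>.\<close>
  define w where "w i t = (W *v (\<phi> t x - mean t)) $ i" for i t
  have w': "(w i has_real_derivative (s i - 1) / sd t i * w i t) (at t within {0..1})"
    if t: "t \<in> {0..1}" for i t
  proof -
    have bl: "bounded_linear (\<lambda>y. (W *v y) $ i)"
      by (rule bounded_linear_compose[OF bounded_linear_vec_nth matrix_vector_mul_bounded_linear])
    have "((\<lambda>t. \<phi> t x) has_vector_derivative vel t (\<phi> t x)) (at t within {0..1})"
      using \<phi> t by (simp add: is_flow_def)
    moreover have "(mean has_vector_derivative m1 - m0) (at t within {0..1})"
      unfolding mean_def[abs_def] by (auto intro!: derivative_eq_intros)
    ultimately have "((\<lambda>t. \<phi> t x - mean t) has_vector_derivative vel t (\<phi> t x) - (m1 - m0)) (at t within {0..1})"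
      by (rule has_vector_derivative_diff)
    from bounded_linear.has_vector_derivative[OF bl this]
    have "(w i has_vector_derivative (W *v (vel t (\<phi> t x) - (m1 - m0))) $ i) (at t within {0..1})"
      by (simp add: w_def[abs_def])
    moreover have "(W *v (vel t (\<phi> t x) - (m1 - m0))) $ i = (s i - 1) / sd t i * w i t"
    proof -
      have "vel t (\<phi> t x) - (m1 - m0) = V *v (diag_mat (\<lambda>i. (s i - 1) / sd t i) *v (W *v (\<phi> t x - mean t)))"
        by (simp add: vel_def)
      then show ?thesis by (simp only: W_V diag_mat_mult_vec vec_lambda_beta w_def)
    qed
    ultimately show ?thesis by (simp add: has_real_derivative_iff_has_vector_derivative)
  qed
  have w: "w i t = sd t i * (W *v (x - m0)) $ i" if t: "t \<in> {0..1}" for i t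
  proof -
    have "((\<lambda>t. w i t / sd t i) has_real_derivative 0) (at t within {0..1})" if t: "t \<in> {0..1}" for t
    proof -
      have nz: "sd t i \<noteq> 0" using sd_pos[OF t, of i] by simp
      have "((\<lambda>t. sd t i) has_real_derivative s i - 1) (at t within {0..1})"
        unfolding sd_def by (auto intro!: derivative_eq_intros)
      from DERIV_divide[OF w'[OF t, of i] this nz] show ?thesis
        using nz by simp
    qed
    then have "\<exists>c. \<forall>t\<in>{0..1}. w i t / sd t i = c"
      by (intro has_field_derivative_zero_constant) auto
    then obtain c where c: "\<And>t. t \<in> {0..1} \<Longrightarrow> w i t / sd t i = c" by blast
    have "c = w i 0 / sd 0 i" using c[of 0] by simp
    also have "\<dots> = (W *v (x - m0)) $ i"
      using \<phi> by (simp add: w_def is_flow_def sd_def mean_def)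
    finally show ?thesis using c[OF t] sd_pos[OF t, of i] by (simp add: field_simps)
  qed
  have "vel t (\<phi> t x) = slope x" if "t \<in> {0..1}" for t
    using w[OF that] by (intro vel_eq_slope that) (simp add: w_def)
  then show ?thesis
    using has_vector_derivative_const[of "slope x" "at t within {0..1}"] t
    by (rule_tac has_vector_derivative_transform[of t "{0..1}" _ "\<lambda>_. slope x"]) auto
qed

section \<open>Endpoint laws and membership in the straight-line class\<close>

lemma X_endpoints: "X 0 \<omega> = fst \<omega>" "X 1 \<omega> = fst (snd \<omega>)"
  by (simp_all add: X_def bridge_coeff_def)

lemma in_S_X: "in_S M X P0 P1"
  unfolding in_S_def
proof (intro conjI ballI AE_I2)
  show "prob_space M" by (rule M.P.prob_space_axioms)
  show "X t \<in> borel_measurable M" for t by (intro continuous_imp_measurable_M continuous_X)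
  show "continuous_on {0..1} (\<lambda>t. X t \<omega>)" for \<omega>
    unfolding X_def by (rule continuous_on_bridge)
  show "(\<lambda>\<omega>. (X 0 \<omega>, X 1 \<omega>)) \<in> measurable M (P0 \<Otimes>\<^sub>M P1)"
    unfolding X_endpoints by measurable
  \<comment> \<open>Forgetting Z projects the second factor of the product onto \<open>P1\<close>,
    so the endpoint pair has the product law.\<close>
  have d: "distr (P1 \<Otimes>\<^sub>M Q) P1 fst = P1" by (rule Q.distr_pair_fst)
  have "distr P0 P0 (\<lambda>x. x) \<Otimes>\<^sub>M distr (P1 \<Otimes>\<^sub>M Q) P1 fst = distr M (P0 \<Otimes>\<^sub>M P1) (\<lambda>(x, y). (x, fst y))"
    by (rule pair_measure_distr) (auto simp: d P1.sigma_finite_measure_axioms)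
  then show "distr M (P0 \<Otimes>\<^sub>M P1) (\<lambda>\<omega>. (X 0 \<omega>, X 1 \<omega>)) = P0 \<Otimes>\<^sub>M P1"
    unfolding X_endpoints d by (simp add: case_prod_unfold distr_id)
qed

lemma in_F_SL_bridge:
  assumes p: "1 \<le> p" "p < 2"
  shows "in_F_SL p (\<lambda>t x y z. (1 - t) *\<^sub>R x + t *\<^sub>R y + sqrt (2 * t * (1 - t)) *\<^sub>R z) Q P0 P1"
proof -
  define F :: "real \<Rightarrow> real^'n \<Rightarrow> real^'n \<Rightarrow> real^'n \<Rightarrow> real^'n"
    where "F t x y z = (1 - t) *\<^sub>R x + t *\<^sub>R y + bridge_coeff t *\<^sub>R z" for t x y z
  have ind: "induced_process F = X"
    by (intro ext) (simp add: induced_process_def F_def X_def)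
  have "base_interp_path p F"
    unfolding base_interp_path_def
  proof (intro conjI AE_I2)
    have "continuous_on ({0..1} \<times> UNIV) (\<lambda>(t, x, y, z). F t x y z)"
      unfolding F_def case_prod_unfold by (intro continuous_intros)
    then show "(\<lambda>(t, x, y, z). F t x y z) \<in> borel_measurable (restrict_space borel ({0..1} \<times> UNIV))"
      by (rule borel_measurable_continuous_on_restrict)
  next
    fix w :: "(real^'n) \<times> (real^'n) \<times> (real^'n)"
    show "W1p_path p (\<lambda>t. F t (fst w) (fst (snd w)) (snd (snd w)))"
      unfolding F_def by (rule W1p_path_bridge[OF p])
  qed (simp_all add: F_def bridge_coeff_def)
  then have "gen_interp p F Q"
    by (simp add: gen_interp_def Q.prob_space_axioms absolutely_continuous_gaussian)
  moreover have "in_S_SL M X P0 P1"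
    unfolding in_S_SL_def
  proof (intro conjI absolutely_continuous_gaussian in_S_X, rule exI[of _ vel],
      intro conjI cond_velocity_X vel_lipschitz allI impI ballI)
    show "\<exists>\<phi>. is_flow vel \<phi>" using is_flow_affine by blast
  qed (rule flow_acceleration_zero)
  ultimately have "in_F_SL p F Q P0 P1" by (simp add: in_F_SL_def ind)
  then show ?thesis by (simp only: F_def[abs_def] bridge_coeff_def)
qed

end

theorem theorem3p7:
  fixes p :: real and m0 m1 :: "real^'n" and S0 S1 :: "real^'n^'n"
  assumes "1 \<le> p" and "p < 2"
    and "pos_def_mat S0" and "pos_def_mat S1"
  shows "\<exists>(\<Lambda>::real^'n^'n) (V::real^'n^'n). diagonal_mat \<Lambda> \<and> S0 = V ** transpose V \<and> S1 = V ** \<Lambda> ** transpose V \<and>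
           pos_def_mat (V ** diag_sqrt \<Lambda> ** transpose V) \<and>
           in_F_SL p (\<lambda>t x y z. (1 - t) *\<^sub>R x + t *\<^sub>R y + sqrt (2 * t * (1 - t)) *\<^sub>R z)
             (gaussian 0 (V ** diag_sqrt \<Lambda> ** transpose V))
             (gaussian m0 S0) (gaussian m1 S1)"
proof -
  obtain V W :: "real^'n^'n" and d where VW: "V ** W = mat 1" "W ** V = mat 1" and d: "\<And>i. 0 < d i"
    and S: "S0 = V ** transpose V" "S1 = V ** diag_mat d ** transpose V"
    using simultaneous_diagonalization[OF assms(3,4)] by metis
  \<comment> \<open>With \<open>\<Lambda> = diag_mat d\<close>, \<open>s\<close> is the diagonal of
    \<open>diag_sqrt \<Lambda>\<close>, which matches the covariance of Z in the locale.\<close>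
  define s where "s i = sqrt (d i)" for i
  have s: "0 < s i" "(s i)\<^sup>2 = d i" for i using d[of i] by (simp_all add: s_def)
  interpret gaussian_endpoints m0 m1 V W s by standard (use VW s in auto)
  have "diag_sqrt (diag_mat d) = diag_mat s" by (simp add: diag_sqrt_diag_mat s_def[abs_def])
  then have "pos_def_mat (V ** diag_sqrt (diag_mat d) ** transpose V)"
    "in_F_SL p (\<lambda>t x y z. (1 - t) *\<^sub>R x + t *\<^sub>R y + sqrt (2 * t * (1 - t)) *\<^sub>R z)
       (gaussian 0 (V ** diag_sqrt (diag_mat d) ** transpose V)) (gaussian m0 S0) (gaussian m1 S1)"
    using pos_def_congruence[OF VW(1) s(1)] in_F_SL_bridge[OF assms(1,2)] by (simp_all add: S s(2))
  then show ?thesis using S diagonal_diag_mat by blast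
qed

end
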